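(* There exist an absolute constant $C>0$ and an adaptive algorithm for the distribution 2-clustering problem in which one of the two cluster distributions, $Q$, is a known distribution on $[n]$ and the other, $P$, is unknown. Given $n,k,\varepsilon$, the description of $Q$, and $r$ (the number of indices $i$ with $D_i=P$), the algorithm outputs the hidden partition with probability at least $2/3$, using at most $$C\left(\frac{k\log k\sqrt n}{r\varepsilon^2}+\frac{\sqrt{nk\log k}}{\varepsilon^2}\right)\ \text{ samples if } n\ge k\log k,\qquad C\left(\frac{k\log k\sqrt n}{r\varepsilon^2}+\frac{k\log k}{\varepsilon^2}\right)\ \text{ samples if } n\le k\log k.$$
   Context: Distribution 2-clustering problem: the input is sample access (adaptive, independent samples on request) to $k\ge2$ distributions $D_1,\dots,D_k$ on $[n]$ and a parameter $\varepsilon\in(0,1]$; it is promised that there is a hidden partition $\{\mathcal I_1,\mathcal I_2\}$ of $[k]$ into two nonempty parts such that all $D_a$ with $a$ in the same part are equal, and $\mathrm{d_{TV}}(D_a,D_b)\ge\varepsilon$ whenever $a\in\mathcal I_1$, $b\in\mathcal I_2$. The goal is to output the partition. $\mathrm{d_{TV}}$ is total variation distance; sample complexity is the total number of samples drawn. *)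

theory Defs
  imports "HOL-Probability.Probability"
begin

definition d_TV :: "'a pmf \<Rightarrow> 'a pmf \<Rightarrow> real" where
  "d_TV p q = (SUP A. \<bar>measure_pmf.prob p A - measure_pmf.prob q A\<bar>)"

text \<open>An adaptive (possibly randomized) sampling algorithm is a map from the history
  of (queried index, received sample) pairs to a distribution over actions:
  either request one more sample from D_i, or halt and output a set S of indices
  (meaning the partition {S, [k] - S}).\<close>
datatype action = Query nat | Output "nat set"

type_synonym algorithm = "(nat \<times> nat) list \<Rightarrow> action pmf"

text \<open>Running an algorithm with a sample budget: run A D b h is the distribution of the
  output, where None means the algorithm tried to draw more than b samples in total.\<close>
fun run :: "algorithm \<Rightarrow> (nat \<Rightarrow> nat pmf) \<Rightarrow> nat \<Rightarrow> (nat \<times> nat) list \<Rightarrow> nat set option pmf" where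
  "run A D 0 h = map_pmf (\<lambda>a. case a of Output S \<Rightarrow> Some S | Query i \<Rightarrow> None) (A h)"
| "run A D (Suc m) h = bind_pmf (A h) (\<lambda>a. case a of
      Output S \<Rightarrow> return_pmf (Some S)
    | Query i \<Rightarrow> bind_pmf (D i) (\<lambda>x. run A D m (h @ [(i, x)])))"

definition budget :: "real \<Rightarrow> nat \<Rightarrow> nat \<Rightarrow> real \<Rightarrow> nat \<Rightarrow> real" where
  "budget C n k \<epsilon> r =
     (if real n \<ge> real k * ln (real k) then
        C * (real k * ln (real k) * sqrt (real n) / (real r * \<epsilon>\<^sup>2)
             + sqrt (real n * real k * ln (real k)) / \<epsilon>\<^sup>2)
      else
        C * (real k * ln (real k) * sqrt (real n) / (real r * \<epsilon>\<^sup>2)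
             + real k * ln (real k) / \<epsilon>\<^sup>2))"

end

theory Submission
  imports Defs
begin

text \<open>
  From \<open>m\<close> training samples of \<open>P\<close> one learns a score \<open>f\<close> on \<open>{1..n}\<close>, namely
  \<open>(N i / m - q i) / w i\<close> with \<open>N i\<close> the multiplicity of \<open>i\<close> and \<open>w i = q i + 1 / n\<close>, where the
  count enters only through \<open>(1 - \<theta> i) ^ N i\<close>. This damping bounds the score, and its moments have
  closed forms: \<open>(1 - \<theta> i) ^ N i\<close> is a product over independent samples, and these variables are
  negatively correlated. With constant probability over the training, the mean of \<open>s\<close> scores then
  separates \<open>P\<close> from \<open>Q\<close> as soon as \<open>m \<ge> C \<surd>n / \<epsilon>\<^sup>2\<close>, \<open>s \<ge> C / \<epsilon>\<^sup>2\<close> and \<open>m s \<ge> C n / \<epsilon>\<^sup>4\<close>; the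
  rejection threshold is computed from \<open>Q\<close>, so that \<open>Q\<close> is accepted whatever the training was.

  The algorithm tests about \<open>k / r\<close> random indices, each trained on its own samples with
  \<open>m = s = C \<surd>n / \<epsilon>\<^sup>2\<close>, until it has an index of \<open>P\<close>. It then trains once on that index and
  classifies every index with this single training set. Only the test samples are repeated
  \<open>O(log k)\<close> times for a majority vote, which is what turns \<open>log k\<close> into \<open>\<surd>(log k)\<close> when \<open>m\<close> and
  \<open>s\<close> are balanced subject to \<open>m s \<ge> C n / \<epsilon>\<^sup>4\<close>.
\<close>

subsection \<open>Strategies with a fixed number of queries\<close>

primrec hist :: "((nat \<times> nat) list \<Rightarrow> nat pmf) \<Rightarrow> (nat \<Rightarrow> nat pmf) \<Rightarrow> nat \<Rightarrow> (nat \<times> nat) list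
    \<Rightarrow> (nat \<times> nat) list pmf" where
  "hist q D 0 h = return_pmf h"
| "hist q D (Suc N) h = bind_pmf (q h) (\<lambda>i. bind_pmf (D i) (\<lambda>x. hist q D N (h @ [(i, x)])))"

text \<open>\<open>q\<close> and \<open>out\<close> are chosen before \<open>D\<close>, so a
  realizable experiment learns about \<open>D\<close> only through its samples. The length
  \<open>N\<close> is fixed in advance, which reduces bounding the sample complexity to adding and
  multiplying lengths.\<close>

definition realizable :: "nat \<Rightarrow> ((nat \<Rightarrow> nat pmf) \<Rightarrow> 'a pmf) \<Rightarrow> bool" where
  "realizable N F \<longleftrightarrow> (\<exists>q out. \<forall>D. F D = map_pmf out (hist q D N []))"

lemma hist_add: "hist q D (a + b) h = bind_pmf (hist q D a h) (hist q D b)"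
  by (induction a arbitrary: h) (simp_all add: bind_return_pmf bind_assoc_pmf)

lemma length_hist: "h' \<in> set_pmf (hist q D N h) \<Longrightarrow> length h' = length h + N"
  by (induction N arbitrary: h) fastforce+

lemma hist_cong:
  assumes "\<And>g. length h \<le> length g \<Longrightarrow> length g < length h + N \<Longrightarrow> q g = q' g"
  shows "hist q D N h = hist q' D N h"
  using assms
proof (induction N arbitrary: h)
  case (Suc N)
  have "hist q D N (h @ [y]) = hist q' D N (h @ [y])" for y
    by (rule Suc.IH) (simp add: Suc.prems)
  then show ?case by (simp add: Suc.prems)
qed simp

lemma hist_shift:
  assumes "\<And>g. q (h @ g) = q' g"
  shows "hist q D N (h @ g) = map_pmf ((@) h) (hist q' D N g)"
proof (induction N arbitrary: g)
  case (Suc N)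
  show ?case
    using Suc.IH by (simp add: assms map_bind_pmf)
qed simp

lemma realizable_return: "realizable 0 (\<lambda>D. return_pmf x)"
  by (auto simp: realizable_def)

lemma realizable_sample: "realizable (Suc 0) (\<lambda>D. D i)"
  unfolding realizable_def
  by (rule exI[of _ "\<lambda>_. return_pmf i"], rule exI[of _ "\<lambda>h. snd (hd h)"])
    (simp add: bind_return_pmf map_bind_pmf bind_return_pmf')

text \<open>Queries are the only source of recorded randomness in the model, so a coin toss costs
  one sample, which is thrown away.\<close>
lemma realizable_random: "realizable (Suc 0) (\<lambda>D. M :: nat pmf)"
  unfolding realizable_def
  by (rule exI[of _ "\<lambda>_. M"], rule exI[of _ "\<lambda>h. fst (hd h)"])
    (simp add: map_bind_pmf bind_return_pmf')

text \<open>All randomness of the first stage is recorded in the history. The second stage can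
  therefore recompute the first result from the first \<open>N\<close> records and treat the
  remaining ones as its own history.\<close>

lemma realizable_bind:
  assumes F: "realizable N F" and G: "\<And>a. realizable M (G a)"
  shows "realizable (N + M) (\<lambda>D. bind_pmf (F D) (\<lambda>a. G a D))"
proof -
  obtain q1 o1 where 1: "\<And>D. F D = map_pmf o1 (hist q1 D N [])"
    using F unfolding realizable_def by blast
  obtain q2 o2 where 2: "\<And>a D. G a D = map_pmf (o2 a) (hist (q2 a) D M [])"
    using G unfolding realizable_def by metis
  define q where "q h = (if length h < N then q1 h else q2 (o1 (take N h)) (drop N h))" for h
  define out where "out h = o2 (o1 (take N h)) (drop N h)" for h
  have "map_pmf out (hist q D (N + M) []) = bind_pmf (F D) (\<lambda>a. G a D)" for D
  proof -
    have "map_pmf out (hist q D M h) = G (o1 h) D" if "h \<in> set_pmf (hist q1 D N [])" for h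
    proof -
      have l: "length h = N"
        using length_hist[OF that] by simp
      have "hist q D M (h @ []) = map_pmf ((@) h) (hist (q2 (o1 h)) D M [])"
        by (rule hist_shift) (simp add: q_def l)
      then show ?thesis
        by (simp add: 2 map_pmf_comp out_def l)
    qed
    moreover have "hist q D N [] = hist q1 D N []"
      by (rule hist_cong) (simp add: q_def)
    ultimately show ?thesis
      by (simp add: hist_add map_bind_pmf 1 bind_map_pmf cong: bind_pmf_cong)
  qed
  then show ?thesis
    unfolding realizable_def by metis
qed

lemma realizable_map:
  assumes "realizable N F"
  shows "realizable N (\<lambda>D. map_pmf g (F D))"
  using realizable_bind[OF assms realizable_return, of g]
  by (simp add: map_pmf_def)

lemma realizable_replicate:
  assumes "realizable N F"
  shows "realizable (T * N) (\<lambda>D. replicate_pmf T (F D))"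
proof (induction T)
  case 0
  show ?case using realizable_return by simp
next
  case (Suc T)
  have "realizable (N + T * N) (\<lambda>D. bind_pmf (F D) (\<lambda>x. map_pmf ((#) x) (replicate_pmf T (F D))))"
    by (intro realizable_bind assms realizable_map Suc)
  then show ?case by (simp add: map_pmf_def)
qed

lemma realizable_samples: "realizable m (\<lambda>D. replicate_pmf m (D i))"
  using realizable_replicate[OF realizable_sample, of m] by simp

text \<open>A fixed-length strategy becomes an algorithm of the model by halting once the history
  has length \<open>N\<close>. Halting costs no sample, so a budget equal to the number of remaining
  queries suffices.\<close>

lemma run_hist:
  assumes "length h + M = N" "M \<le> b"
  shows "run (\<lambda>h. if length h < N then map_pmf Query (q h) else return_pmf (Output (out h))) D b h
    = map_pmf (\<lambda>h. Some (out h)) (hist q D M h)"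
  using assms
proof (induction M arbitrary: b h)
  case 0
  then show ?case by (cases b) (simp_all add: bind_return_pmf)
next
  case (Suc M)
  then obtain b' where b: "b = Suc b'" "M \<le> b'" by (cases b) auto
  show ?case
    using Suc.prems b(2) by (simp add: b(1) bind_map_pmf map_bind_pmf Suc.IH)
qed

lemma realizable_run:
  assumes "realizable N F"
  obtains A where "\<And>D b. N \<le> b \<Longrightarrow> run A D b [] = map_pmf Some (F D)"
proof -
  obtain q out where F: "\<And>D. F D = map_pmf out (hist q D N [])"
    using assms unfolding realizable_def by blast
  show ?thesis
    by (rule that[of "\<lambda>h. if length h < N then map_pmf Query (q h) else return_pmf (Output (out h))"],
        subst run_hist[of _ N]) (simp_all add: F map_pmf_comp)
qed

subsection \<open>Probabilities and expectations of composed experiments\<close>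

lemma prob_bind_pmf:
  "measure_pmf.prob (bind_pmf M f) B = measure_pmf.expectation M (\<lambda>x. measure_pmf.prob (f x) B)"
proof -
  have "ennreal (measure_pmf.prob (bind_pmf M f) B) = (\<integral>\<^sup>+x. ennreal (measure_pmf.prob (f x) B) \<partial>M)"
    by (simp add: measure_pmf.emeasure_eq_measure[symmetric])
  also have "\<dots> = ennreal (measure_pmf.expectation M (\<lambda>x. measure_pmf.prob (f x) B))"
    by (intro nn_integral_eq_integral measure_pmf.integrable_const_bound[where B = 1]) auto
  finally show ?thesis
    by (simp add: integral_nonneg_AE)
qed

text \<open>Union bound over two stages: the first fails with probability at most \<open>a\<close>,
  the second with probability at most \<open>b\<close> after any good outcome of the first.\<close>

lemma prob_bind_ge:
  assumes "1 - a \<le> measure_pmf.prob M A" "0 \<le> a" "0 \<le> b" "b \<le> 1"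
    and f: "\<And>x. x \<in> A \<Longrightarrow> x \<in> set_pmf M \<Longrightarrow> 1 - b \<le> measure_pmf.prob (f x) B"
  shows "1 - (a + b) \<le> measure_pmf.prob (bind_pmf M f) B"
proof -
  have "1 - (a + b) \<le> (1 - b) * (1 - a)"
    using assms(2,3) by (simp add: algebra_simps)
  also have "\<dots> \<le> (1 - b) * measure_pmf.prob M A"
    using assms(1,4) by (intro mult_left_mono) auto
  also have "\<dots> = measure_pmf.expectation M (\<lambda>x. (1 - b) * indicator A x)"
    by simp
  also have "\<dots> \<le> measure_pmf.expectation M (\<lambda>x. measure_pmf.prob (f x) B)"
    using f assms(4)
    by (intro integral_mono_AE measure_pmf.integrable_const_bound[where B = 1])
      (auto simp: AE_measure_pmf_iff indicator_def abs_if assms(3))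
  finally show ?thesis
    by (simp add: prob_bind_pmf)
qed

section \<open>Moments of products and sums over independent samples\<close>

lemma finite_set_replicate_pmf:
  "finite (set_pmf M) \<Longrightarrow> finite (set_pmf (replicate_pmf m M))"
  unfolding set_replicate_pmf
  by (rule finite_subset[OF _ finite_lists_length_eq[of "set_pmf M" m]]) (auto simp: lists_eq_set)

lemma expectation_bind_pmf:
  fixes h :: "'b \<Rightarrow> real"
  assumes "finite (set_pmf M)" "\<And>x. x \<in> set_pmf M \<Longrightarrow> finite (set_pmf (f x))"
  shows "measure_pmf.expectation (bind_pmf M f) h
    = measure_pmf.expectation M (\<lambda>x. measure_pmf.expectation (f x) h)"
  using assms by (simp add: pmf_expectation_bind[of "set_pmf M"] integral_measure_pmf[of "set_pmf M"])

lemma expectation_replicate_Suc: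
  fixes h :: "'a list \<Rightarrow> real"
  assumes "finite (set_pmf M)"
  shows "measure_pmf.expectation (replicate_pmf (Suc m) M) h
    = measure_pmf.expectation M (\<lambda>x. measure_pmf.expectation (replicate_pmf m M) (\<lambda>xs. h (x # xs)))"
proof -
  have "replicate_pmf (Suc m) M = bind_pmf M (\<lambda>x. map_pmf ((#) x) (replicate_pmf m M))"
    by (simp add: map_pmf_def)
  then show ?thesis
    using assms by (simp del: replicate_pmf.simps
        add: expectation_bind_pmf finite_set_replicate_pmf)
qed

lemma expectation_replicate_prod:
  fixes g :: "'a \<Rightarrow> real"
  assumes "finite (set_pmf M)"
  shows "measure_pmf.expectation (replicate_pmf m M) (\<lambda>xs. prod_list (map g xs))
    = measure_pmf.expectation M g ^ m"
  by (induction m) (simp_all add: expectation_replicate_Suc assms del: replicate_pmf.simps(2))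

lemma variance_replicate_sum:
  fixes g :: "'a \<Rightarrow> real"
  assumes fin: "finite (set_pmf M)" and mean: "measure_pmf.expectation M g = 0"
  shows "measure_pmf.expectation (replicate_pmf m M) (\<lambda>xs. sum_list (map g xs)) = 0"
    and "measure_pmf.expectation (replicate_pmf m M) (\<lambda>xs. (sum_list (map g xs))\<^sup>2)
      = m * measure_pmf.expectation M (\<lambda>x. (g x)\<^sup>2)"
proof -
  note int = integrable_measure_pmf_finite[OF fin]
    integrable_measure_pmf_finite[OF finite_set_replicate_pmf[OF fin]]
  show 0: "measure_pmf.expectation (replicate_pmf m M) (\<lambda>xs. sum_list (map g xs)) = 0" for m
    by (induction m)
      (simp_all add: expectation_replicate_Suc fin mean int del: replicate_pmf.simps(2))
  show "measure_pmf.expectation (replicate_pmf m M) (\<lambda>xs. (sum_list (map g xs))\<^sup>2)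
      = m * measure_pmf.expectation M (\<lambda>x. (g x)\<^sup>2)"
  proof (induction m)
    case (Suc m)
    have "measure_pmf.expectation (replicate_pmf m M) (\<lambda>xs. (g x + sum_list (map g xs))\<^sup>2)
      = (g x)\<^sup>2 + m * measure_pmf.expectation M (\<lambda>x. (g x)\<^sup>2)" for x
    proof -
      have "(\<lambda>xs. (g x + sum_list (map g xs))\<^sup>2)
        = (\<lambda>xs. (g x)\<^sup>2 + (2 * g x) * sum_list (map g xs) + (sum_list (map g xs))\<^sup>2)"
        by (auto simp: power2_sum)
      then show ?thesis
        using Suc by (simp add: int 0)
    qed
    then show ?case
      by (simp add: expectation_replicate_Suc fin int algebra_simps del: replicate_pmf.simps(2))
  qed simp
qed

text \<open>Markov's inequality.\<close>

lemma prob_ge_le_expectation: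
  fixes f :: "'a \<Rightarrow> real"
  assumes "finite (set_pmf M)" "\<And>x. 0 \<le> f x" "0 < c"
  shows "measure_pmf.prob M {x. c \<le> f x} \<le> measure_pmf.expectation M f / c"
proof -
  have "c * measure_pmf.prob M {x. c \<le> f x} = measure_pmf.expectation M (\<lambda>x. c * indicator {x. c \<le> f x} x)"
    by simp
  also have "\<dots> \<le> measure_pmf.expectation M f"
    using assms by (intro integral_mono integrable_measure_pmf_finite) (auto simp: indicator_def)
  finally show ?thesis
    using assms(3) by (simp add: field_simps)
qed

subsection \<open>Majority votes, search and classification\<close>

definition majority :: "nat \<Rightarrow> bool pmf \<Rightarrow> bool pmf" where
  "majority L M = map_pmf (\<lambda>bs. L < 2 * count_list bs True) (replicate_pmf L M)"

lemma count_list_True_False: "count_list bs True + count_list bs False = length bs"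
  by (induction bs) auto

lemma power_count_list:
  "c ^ count_list xs i = prod_list (map (\<lambda>x. if x = i then c else (1::real)) xs)"
  by (induction xs) auto

text \<open>Chernoff bound by Markov's inequality for the exponential moment of the number of wrong
  votes. A tie counts as wrong here, which covers both values of \<open>v\<close>.\<close>

lemma majority_error:
  assumes "measure_pmf.prob M {v} \<ge> 9 / 10"
  shows "measure_pmf.prob (majority L M) {v} \<ge> 1 - (3 / 5) ^ L"
proof -
  have fin: "finite (set_pmf M)"
    by (rule finite_subset[of _ UNIV]) auto
  let ?R = "replicate_pmf L M"
  \<comment> \<open>With base 9, half of the votes being wrong already gives \<open>3 ^ L\<close>,
    while one vote has moment at most 1 + 8/10 = 9/5. The quotient of the two is 3/5 per
    vote.\<close>
  let ?W = "{bs. (3::real) ^ L \<le> 9 ^ count_list bs (\<not> v)}"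
  have pv: "pmf M True + pmf M False = 1"
    using sum_pmf_eq_1[of "{True, False}" M] by auto
  have "measure_pmf.expectation M (\<lambda>b. if b = (\<not> v) then 9 else (1::real))
      = (\<Sum>b\<in>UNIV. pmf M b * (if b = (\<not> v) then 9 else (1::real)))"
    by (subst integral_measure_pmf[of UNIV]) auto
  also have "\<dots> = 9 - 8 * pmf M v"
    using pv by (cases v) (simp_all add: UNIV_bool)
  also have "\<dots> \<le> 9 / 5"
    using assms by (simp add: measure_pmf_single)
  finally have e: "measure_pmf.expectation M (\<lambda>b. if b = (\<not> v) then 9 else (1::real)) \<le> 9 / 5" .
  have "measure_pmf.prob ?R ?W \<le> measure_pmf.expectation ?R (\<lambda>bs. 9 ^ count_list bs (\<not> v)) / 3 ^ L"
    by (rule prob_ge_le_expectation) (auto intro: finite_set_replicate_pmf fin)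
  also have "\<dots> = measure_pmf.expectation M (\<lambda>b. if b = (\<not> v) then 9 else (1::real)) ^ L / 3 ^ L"
    by (simp only: power_count_list expectation_replicate_prod[OF fin])
  also have "\<dots> \<le> (9 / 5) ^ L / 3 ^ L"
    using e by (intro divide_right_mono power_mono integral_nonneg_AE) auto
  also have "\<dots> = (3 / 5) ^ L"
    by (simp flip: power_divide)
  finally have "measure_pmf.prob ?R (- ?W) \<ge> 1 - (3 / 5) ^ L"
    using measure_pmf.prob_compl[of ?W ?R] by (simp add: Compl_eq_Diff_UNIV)
  also have "measure_pmf.prob ?R (- ?W) = measure_pmf.prob ?R (- ?W \<inter> set_pmf ?R)"
    by (simp add: measure_Int_set_pmf)
  also have "\<dots> \<le> measure_pmf.prob ?R {bs. (L < 2 * count_list bs True) = v}"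
  proof (rule measure_pmf.finite_measure_mono)
    show "- ?W \<inter> set_pmf ?R \<subseteq> {bs. (L < 2 * count_list bs True) = v}"
    proof
      fix bs assume bs: "bs \<in> - ?W \<inter> set_pmf ?R"
      have "(9::real) ^ count_list bs (\<not> v) = 3 ^ (2 * count_list bs (\<not> v))"
        by (simp add: power_mult)
      with bs have "2 * count_list bs (\<not> v) < L"
        by auto
      moreover have "length bs = L"
        using bs by (simp add: set_replicate_pmf)
      ultimately show "bs \<in> {bs. (L < 2 * count_list bs True) = v}"
        using count_list_True_False[of bs] by (cases v) auto
    qed
  qed simp
  finally show ?thesis
    unfolding majority_def measure_map_pmf by (simp add: vimage_def)
qed

lemma realizable_majority:
  assumes "realizable N F"
  shows "realizable (L * N) (\<lambda>D. majority L (F D))"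
  unfolding majority_def by (intro realizable_map realizable_replicate assms)

section \<open>Random search for an index of the unknown distribution\<close>

primrec first_flagged :: "('a \<times> bool) pmf \<Rightarrow> 'a \<Rightarrow> nat \<Rightarrow> 'a pmf" where
  "first_flagged M d 0 = return_pmf d"
| "first_flagged M d (Suc T)
    = bind_pmf M (\<lambda>(i, b). map_pmf (\<lambda>j. if b then i else j) (first_flagged M d T))"

text \<open>All \<open>T\<close> rounds are carried out even after a flag has been raised; this
  keeps the number of queries fixed.\<close>

lemma realizable_first_flagged:
  assumes "realizable N F"
  shows "realizable (T * N) (\<lambda>D. first_flagged (F D) d T)"
proof (induction T)
  case 0
  show ?case using realizable_return by simp
next
  case (Suc T)
  show ?case
    using realizable_bind[OF assms realizable_map[OF Suc], of "\<lambda>(i, b) j. if b then i else j"]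
    by (simp add: case_prod_unfold)
qed

text \<open>The search fails either by a false flag before any correct one, which costs the
  geometric series e + e (1 - g) + ... <= e / g, or because none of the \<open>T\<close> rounds
  yields a correct flag. In the latter case the default \<open>d\<close> may be wrong, hence the
  term \<open>(1 - g) ^ T\<close>.\<close>

lemma first_flagged_error:
  assumes g: "g \<le> measure_pmf.prob M (I \<times> {True})" "0 < g"
    and e: "measure_pmf.prob M ((- I) \<times> {True}) \<le> e"
  shows "measure_pmf.prob (first_flagged M d T) (- I) \<le> e / g + (1 - g) ^ T"
proof (induction T)
  case 0
  have "0 \<le> e" using e measure_nonneg[of M "(- I) \<times> {True}"] by linarith
  then show ?case
    using g(2) by (simp add: add_increasing)
next
  case (Suc T)
  let ?f = "measure_pmf.prob (first_flagged M d T) (- I)"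
  have g1: "g \<le> 1"
    using g(1) measure_pmf.prob_le_1 order_trans by blast
  have "measure_pmf.prob (first_flagged M d (Suc T)) (- I)
    = measure_pmf.expectation M (\<lambda>(i, b). measure_pmf.prob (first_flagged M d T) {j. (if b then i else j) \<notin> I})"
    by (simp add: prob_bind_pmf case_prod_unfold vimage_def)
  also have "\<dots> = measure_pmf.expectation M
      (\<lambda>x. (indicator ((- I) \<times> {True}) x + ?f * indicator (UNIV \<times> {False}) x))"
  proof (rule Bochner_Integration.integral_cong)
    fix x :: "'a \<times> bool"
    obtain i b where x: "x = (i, b)" by fastforce
    have "{j. j \<notin> I} = - I" by auto
    then show "(case x of (i, b) \<Rightarrow> measure_pmf.prob (first_flagged M d T) {j. (if b then i else j) \<notin> I})
      = indicator ((- I) \<times> {True}) x + ?f * indicator (UNIV \<times> {False}) x"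
      by (cases b; cases "i \<in> I") (auto simp: x)
  qed simp
  also have "\<dots> = measure_pmf.prob M ((- I) \<times> {True}) + ?f * measure_pmf.prob M (UNIV \<times> {False})"
    by (subst Bochner_Integration.integral_add)
      (auto intro!: integrable_mult_right integrable_real_indicator simp: less_top[symmetric])
  also have "\<dots> \<le> e + (e / g + (1 - g) ^ T) * (1 - g)"
  proof (intro add_mono mult_mono e Suc.IH)
    have "measure_pmf.prob M (UNIV \<times> {False}) \<le> measure_pmf.prob M (UNIV - I \<times> {True})"
      by (intro measure_pmf.finite_measure_mono) auto
    also have "\<dots> = 1 - measure_pmf.prob M (I \<times> {True})"
      using measure_pmf.prob_compl[of "I \<times> {True}" M] by simp
    finally show "measure_pmf.prob M (UNIV \<times> {False}) \<le> 1 - g"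
      using g by simp
    have "0 \<le> e" using e measure_nonneg[of M "(- I) \<times> {True}"] by linarith
    then show "0 \<le> e / g + (1 - g) ^ T"
      using g(2) g1 by simp
  qed simp
  also have "\<dots> = e / g + (1 - g) ^ Suc T"
    using g(2) by (simp add: field_simps)
  finally show ?case .
qed

section \<open>Classification of all indices\<close>

primrec classify :: "('a \<Rightarrow> bool pmf) \<Rightarrow> 'a list \<Rightarrow> 'a set pmf" where
  "classify t [] = return_pmf {}"
| "classify t (j # js)
    = bind_pmf (t j) (\<lambda>b. map_pmf (\<lambda>S. if b then insert j S else S) (classify t js))"

lemma realizable_classify:
  assumes "\<And>j. realizable N (\<lambda>D. t j D)"
  shows "realizable (length js * N) (\<lambda>D. classify (\<lambda>j. t j D) js)"
proof (induction js)
  case Nil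
  show ?case using realizable_return by simp
next
  case (Cons j js)
  show ?case
    using realizable_bind[OF assms realizable_map[OF Cons], of j "\<lambda>b S. if b then insert j S else S"]
    by simp
qed

lemma classify_error:
  fixes \<beta> :: real
  assumes "\<And>j. j \<in> set js \<Longrightarrow> 1 - \<beta> \<le> measure_pmf.prob (t j) {j \<in> I}"
    and \<beta>: "0 \<le> \<beta>" "length js * \<beta> \<le> 1"
  shows "1 - length js * \<beta> \<le> measure_pmf.prob (classify t js) {I \<inter> set js}"
  using assms(1) \<beta>(2)
proof (induction js)
  case Nil
  show ?case by simp
next
  case (Cons j js)
  have le: "real (length js) * \<beta> \<le> 1"
    using Cons.prems(2) \<beta>(1) by (simp add: algebra_simps)
  have "1 - (\<beta> + length js * \<beta>) \<le> measure_pmf.prob (classify t (j # js)) {I \<inter> set (j # js)}"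
    unfolding classify.simps
  proof (rule prob_bind_ge[where A = "{j \<in> I}"])
    show "1 - \<beta> \<le> measure_pmf.prob (t j) {j \<in> I}"
      using Cons.prems(1) by simp
    fix b assume "b \<in> {j \<in> I}"
    then have b: "b \<longleftrightarrow> j \<in> I" by simp
    have "1 - length js * \<beta> \<le> measure_pmf.prob (classify t js) {I \<inter> set js}"
      using Cons.IH Cons.prems(1) le by simp
    also have "\<dots> \<le> measure_pmf.prob (classify t js)
        ((\<lambda>S. if b then insert j S else S) -` {I \<inter> set (j # js)})"
      by (intro measure_pmf.finite_measure_mono) (auto simp: b)
    finally show "1 - length js * \<beta> \<le> measure_pmf.prob
        (map_pmf (\<lambda>S. if b then insert j S else S) (classify t js)) {I \<inter> set (j # js)}"
      by simp
  qed (use \<beta>(1) le in auto)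
  then show ?case by (simp add: algebra_simps)
qed

subsection \<open>The damped count statistic at a single point\<close>

lemma power_diff_le_mult:
  fixes x y :: real
  assumes "0 \<le> y" "y \<le> x" "x \<le> 1"
  shows "x ^ m - y ^ m \<le> m * (x - y)"
proof (induction m)
  case (Suc m)
  have "x ^ Suc m - y ^ Suc m = x * (x ^ m - y ^ m) + (x - y) * y ^ m"
    by (simp add: algebra_simps)
  also have "\<dots> \<le> 1 * (x ^ m - y ^ m) + (x - y) * 1"
    using assms by (intro add_mono mult_mono) (auto simp: power_mono power_le_one)
  finally show ?case using Suc by (simp add: algebra_simps)
qed simp

lemma one_minus_power_ge:
  fixes y :: real
  assumes "0 \<le> y" "y \<le> 1"
  shows "min 1 (m * y) / 2 \<le> 1 - (1 - y) ^ m"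
proof -
  define z where "z = m * y"
  have z: "0 \<le> z" using assms by (simp add: z_def)
  have "(1 - y) ^ m \<le> exp (- y) ^ m"
    using assms exp_ge_add_one_self[of "- y"] by (intro power_mono) auto
  also have "\<dots> = inverse (exp z)"
    by (simp add: z_def exp_of_nat_mult exp_minus power_inverse)
  also have "\<dots> \<le> inverse (1 + z)"
    using z exp_ge_add_one_self[of z] by (intro le_imp_inverse_le) auto
  also have "\<dots> \<le> 1 - min 1 z / 2"
  proof (cases "z \<le> 1")
    case True
    have "z * z \<le> z * 1" using True z by (intro mult_left_mono)
    then show ?thesis using True z by (simp add: field_simps)
  next
    case False
    then show ?thesis by (simp add: field_simps)
  qed
  finally show ?thesis by (simp add: z_def)
qed

lemma square_mult_power_le:
  fixes y :: real
  assumes "0 \<le> y" "y \<le> 1" "1 \<le> m"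
  shows "(m * y)\<^sup>2 * (1 - y) ^ (m - 1) \<le> 8"
proof (cases "m = 1")
  case True
  then show ?thesis using assms power_le_one[of y 2] by simp
next
  case False
  \<comment> \<open>For \<open>m\<close> at least 2 the exponent \<open>m - 1\<close> is at least
    \<open>m / 2\<close>, so the power is at most \<open>exp (- z)\<close>. It then remains to bound
    4 z^2 by 8 exp z.\<close>
  define z where "z = m * y / 2"
  have z: "0 \<le> z" using assms by (simp add: z_def)
  have "(1 - y) ^ (m - 1) \<le> exp (- y) ^ (m - 1)"
    using assms exp_ge_add_one_self[of "- y"] by (intro power_mono) auto
  also have "\<dots> = exp (- (real (m - 1) * y))"
    by (simp add: exp_of_nat_mult[symmetric])
  also have "\<dots> \<le> exp (- z)"
  proof -
    have "real m / 2 * y \<le> real (m - 1) * y"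
      using False assms by (intro mult_right_mono) (auto simp: of_nat_diff)
    then show ?thesis by (simp add: z_def)
  qed
  finally have "(1 - y) ^ (m - 1) \<le> exp (- z)" .
  then have "(m * y)\<^sup>2 * (1 - y) ^ (m - 1) \<le> (2 * z)\<^sup>2 * exp (- z)"
    by (simp add: z_def mult_left_mono)
  also have "\<dots> \<le> 8"
  proof -
    have "1 + z + z\<^sup>2 / 2 \<le> exp z"
      using exp_lower_Taylor_quadratic[OF z] by simp
    then have "4 * z\<^sup>2 \<le> 8 * exp z" using z by linarith
    then show ?thesis by (simp add: exp_minus field_simps power2_eq_square)
  qed
  finally show ?thesis .
qed

text \<open>Here \<open>p\<close> and \<open>q\<close> are the probabilities of one point under the two distributions,
  \<open>w = q + 1 / n\<close>, and the point carries the score \<open>a * ((1 - \<theta> q) ^ m - (1 - \<theta>) ^ N)\<close>, where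
  \<open>N\<close> is its multiplicity among \<open>m\<close> training samples. For small \<open>N\<close> this is about
  \<open>(N / m - q) / w\<close>; the damping keeps the score below \<open>a\<close>, so that points that are far heavier
  under \<open>p\<close> than under \<open>q\<close> do not ruin the variance.\<close>
locale point =
  fixes m :: nat and p q w \<theta> a :: real
  assumes m: "1 \<le> m"
    and p: "0 \<le> p" "p \<le> 1"
    and q: "0 \<le> q" "q \<le> 1" "q \<le> w"
    and w: "0 < w"
    and \<theta>_def: "\<theta> = 1 / (1 + 2 * m * w)"
    and a_def: "a = 2 + 1 / (m * w)"
begin

definition "\<delta> = p - q"
text \<open>These are training moments in closed form: \<open>\<mu>\<close> is the mean of the
  score, and \<open>v\<close> below is the variance of \<open>(1 - \<theta>) ^ N\<close>, because
  squaring \<open>1 - \<theta>\<close> replaces \<open>\<theta>\<close> by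
  \<open>2 * \<theta> - \<theta>\<^sup>2\<close>. The score has variance
  \<open>a\<^sup>2 * v\<close>.\<close>

definition "\<mu> = a * ((1 - \<theta> * q) ^ m - (1 - \<theta> * p) ^ m)"
definition "v = (1 - (2 * \<theta> - \<theta>\<^sup>2) * p) ^ m - ((1 - \<theta> * p) ^ m)\<^sup>2"
text \<open>The contribution of the point to a chi-square distance,
  \<open>\<delta>\<^sup>2 / w\<close>, truncated where the score saturates at \<open>a\<close>. It
  is the common scale of the signal and of the noise.\<close>

definition "\<kappa> = \<bar>\<delta>\<bar> * min a (\<bar>\<delta>\<bar> / w)"

lemma mw: "0 < real m * w"
  using m w by simp

lemma \<theta>: "0 < \<theta>" "\<theta> \<le> 1" "m * \<theta> * w \<le> 1 / 2"
  using mw unfolding \<theta>_def by (auto simp: field_simps add_pos_pos)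

text \<open>The normalisation \<open>a * \<theta> * (m * w) = 1\<close> makes each training hit
  contribute \<open>1 / (m * w)\<close> to first order in \<open>\<theta>\<close>, as in the
  undamped score.\<close>

lemma a: "2 \<le> a" "a * \<theta> * (m * w) = 1"
proof -
  show "2 \<le> a" using mw by (simp add: a_def)
  have "a * (m * w) = 1 + 2 * (m * w)"
    using mw w m by (simp add: a_def field_simps)
  moreover have "1 + 2 * (m * w) \<noteq> 0" using mw by linarith
  ultimately show "a * \<theta> * (m * w) = 1"
    unfolding \<theta>_def by (simp add: mult.assoc mult.commute)
qed

lemma \<theta>_mult: "0 \<le> \<theta> * p" "\<theta> * p \<le> 1" "0 \<le> \<theta> * q" "\<theta> * q \<le> 1"
  using \<theta> p q by (simp_all add: mult_le_one)

lemma \<kappa>_nonneg: "0 \<le> \<kappa>"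
  using a(1) w by (simp add: \<kappa>_def)

text \<open>The two bounds come from the powers lying between 0 and 1, and from the Lipschitz
  constant \<open>m\<close> of the power together with the normalisation of
  \<open>a\<close>.\<close>

lemma abs_\<mu>_le: "\<bar>\<mu>\<bar> \<le> min a (\<bar>\<delta>\<bar> / w)"
proof -
  define x y where "x = 1 - \<theta> * q" and "y = 1 - \<theta> * p"
  have xy: "0 \<le> x" "x \<le> 1" "0 \<le> y" "y \<le> 1"
    using \<theta>_mult by (auto simp: x_def y_def)
  have "0 \<le> x ^ m" "x ^ m \<le> 1" "0 \<le> y ^ m" "y ^ m \<le> 1"
    using xy by (auto simp: power_le_one)
  then have 1: "\<bar>x ^ m - y ^ m\<bar> \<le> 1" by linarith
  have "\<bar>x ^ m - y ^ m\<bar> \<le> m * \<bar>x - y\<bar>"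
  proof (cases "y \<le> x")
    case True
    have "y ^ m \<le> x ^ m" using True xy by (intro power_mono)
    then show ?thesis using power_diff_le_mult[of y x m] True xy by simp
  next
    case False
    have "x ^ m \<le> y ^ m" using False xy by (intro power_mono) auto
    then show ?thesis using power_diff_le_mult[of x y m] False xy by simp
  qed
  also have "\<bar>x - y\<bar> = \<theta> * \<bar>\<delta>\<bar>"
    using \<theta>(1) by (simp add: x_def y_def \<delta>_def abs_mult flip: right_diff_distrib)
  finally have "a * \<bar>x ^ m - y ^ m\<bar> \<le> a * (m * (\<theta> * \<bar>\<delta>\<bar>))"
    using a(1) by (intro mult_left_mono) auto
  also have "\<dots> = (a * \<theta> * (m * w)) * (\<bar>\<delta>\<bar> / w)"
    using w by (simp add: field_simps)
  finally have 2: "a * \<bar>x ^ m - y ^ m\<bar> \<le> \<bar>\<delta>\<bar> / w"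
    by (simp add: a(2))
  have 3: "a * \<bar>x ^ m - y ^ m\<bar> \<le> a * 1"
    using a(1) 1 by (intro mult_left_mono) auto
  have "\<bar>\<mu>\<bar> = a * \<bar>x ^ m - y ^ m\<bar>"
    using a(1) by (simp add: \<mu>_def x_def y_def abs_mult)
  then show ?thesis using 2 3 by simp
qed

text \<open>Since \<open>1 - \<theta> * (u + t)\<close> is at most
  \<open>(1 - \<theta> * u) * (1 - \<theta> * t)\<close>, the difference factors. Bernoulli's
  inequality keeps the factor of \<open>u\<close> above 1/2.\<close>

lemma gap: "u \<in> {0..1} \<Longrightarrow> t \<in> {0..1} \<Longrightarrow> u + t \<le> 1 \<Longrightarrow> m * (\<theta> * u) \<le> 1 / 2 \<Longrightarrow>
  min 1 (m * (\<theta> * t)) / 4 \<le> (1 - \<theta> * u) ^ m - (1 - \<theta> * (u + t)) ^ m"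
proof -
  assume u: "u \<in> {0..1}" and t: "t \<in> {0..1}" and ut: "u + t \<le> 1" and mu: "m * (\<theta> * u) \<le> 1 / 2"
  have b: "0 \<le> \<theta> * u" "\<theta> * u \<le> 1" "0 \<le> \<theta> * t" "\<theta> * t \<le> 1" "\<theta> * (u + t) \<le> 1"
    using \<theta> u t ut by (auto simp: mult_le_one)
  have "(1 - \<theta> * (u + t)) ^ m \<le> ((1 - \<theta> * u) * (1 - \<theta> * t)) ^ m"
  proof (intro power_mono)
    have "0 \<le> (\<theta> * u) * (\<theta> * t)" by (rule mult_nonneg_nonneg) (use b in simp_all)
    then show "1 - \<theta> * (u + t) \<le> (1 - \<theta> * u) * (1 - \<theta> * t)"
      by (simp add: algebra_simps)
  qed (use b in simp)
  then have "(1 - \<theta> * u) ^ m * (1 - (1 - \<theta> * t) ^ m) \<le> (1 - \<theta> * u) ^ m - (1 - \<theta> * (u + t)) ^ m"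
    unfolding power_mult_distrib by (simp add: right_diff_distrib)
  moreover have "1 / 2 * (min 1 (m * (\<theta> * t)) / 2) \<le> (1 - \<theta> * u) ^ m * (1 - (1 - \<theta> * t) ^ m)"
  proof (rule mult_mono)
    have "1 + real m * (- (\<theta> * u)) \<le> (1 + - (\<theta> * u)) ^ m"
      by (rule Bernoulli_inequality) (use b in auto)
    then show "1 / 2 \<le> (1 - \<theta> * u) ^ m" using mu by simp
    show "min 1 (m * (\<theta> * t)) / 2 \<le> 1 - (1 - \<theta> * t) ^ m"
      by (rule one_minus_power_ge) (use b in auto)
  qed (use b in auto)
  ultimately show ?thesis by simp
qed

text \<open>The mean score has the sign of \<open>\<delta>\<close>, so no point works against the
  signal. In both cases \<open>gap\<close> is applied with \<open>u\<close> the smaller of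
  \<open>p\<close> and \<open>q\<close> and \<open>t\<close> their distance.\<close>

lemma \<delta>_\<mu>_ge: "\<kappa> / 4 \<le> \<delta> * \<mu>"
proof -
  have e: "a * min 1 (m * (\<theta> * \<bar>\<delta>\<bar>)) = min a (\<bar>\<delta>\<bar> / w)"
  proof -
    have "a * (m * (\<theta> * \<bar>\<delta>\<bar>)) = (a * \<theta> * (m * w)) * (\<bar>\<delta>\<bar> / w)"
      using w by (simp add: field_simps)
    then show ?thesis using a by (simp add: min_mult_distrib_left)
  qed
  \<comment> \<open>As \<open>q\<close> is at most \<open>w\<close>, the choice of
    \<open>\<theta>\<close> meets the hypothesis of \<open>gap\<close> for \<open>q\<close>, and
    hence for \<open>p\<close> when \<open>p\<close> is smaller.\<close>
  have mq: "m * (\<theta> * q) \<le> 1 / 2"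
  proof -
    have "m * \<theta> * q \<le> m * \<theta> * w" using \<theta>(1) q by (intro mult_left_mono) auto
    then show ?thesis using \<theta>(3) by (simp add: mult.assoc)
  qed
  have "min 1 (m * (\<theta> * \<bar>\<delta>\<bar>)) / 4 * \<bar>\<delta>\<bar> \<le> \<delta> * ((1 - \<theta> * q) ^ m - (1 - \<theta> * p) ^ m)"
  proof (cases "q \<le> p")
    case True
    have "min 1 (m * (\<theta> * \<delta>)) / 4 \<le> (1 - \<theta> * q) ^ m - (1 - \<theta> * (q + \<delta>)) ^ m"
      by (rule gap) (use True p q mq in \<open>auto simp: \<delta>_def\<close>)
    then have "min 1 (m * (\<theta> * \<delta>)) / 4 * \<delta> \<le> ((1 - \<theta> * q) ^ m - (1 - \<theta> * (q + \<delta>)) ^ m) * \<delta>"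
      by (rule mult_right_mono) (use True in \<open>simp add: \<delta>_def\<close>)
    then show ?thesis using True by (simp add: \<delta>_def mult.commute)
  next
    case False
    have "m * (\<theta> * p) \<le> m * (\<theta> * q)" using False \<theta>(1) by (intro mult_left_mono) auto
    then have "min 1 (m * (\<theta> * (- \<delta>))) / 4 \<le> (1 - \<theta> * p) ^ m - (1 - \<theta> * (p + - \<delta>)) ^ m"
      using mq by (intro gap) (use False p q in \<open>auto simp: \<delta>_def\<close>)
    then have "min 1 (m * (\<theta> * (- \<delta>))) / 4 * (- \<delta>)
        \<le> ((1 - \<theta> * p) ^ m - (1 - \<theta> * (p + - \<delta>)) ^ m) * (- \<delta>)"
      by (rule mult_right_mono) (use False in \<open>simp add: \<delta>_def\<close>)
    then show ?thesis using False by (simp add: \<delta>_def algebra_simps)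
  qed
  then have "a * (min 1 (m * (\<theta> * \<bar>\<delta>\<bar>)) / 4 * \<bar>\<delta>\<bar>) \<le> a * (\<delta> * ((1 - \<theta> * q) ^ m - (1 - \<theta> * p) ^ m))"
    using a(1) by (intro mult_left_mono) auto
  moreover have "\<delta> * \<mu> = a * (\<delta> * ((1 - \<theta> * q) ^ m - (1 - \<theta> * p) ^ m))"
    by (simp add: \<mu>_def)
  moreover have "\<kappa> / 4 = a * (min 1 (m * (\<theta> * \<bar>\<delta>\<bar>)) / 4 * \<bar>\<delta>\<bar>)"
    by (simp add: \<kappa>_def flip: e)
  ultimately show ?thesis by (simp only:)
qed

section \<open>Variance of the damped count\<close>

lemma second_moment_base:
  "0 \<le> 1 - (2 * \<theta> - \<theta>\<^sup>2) * p" "1 - (2 * \<theta> - \<theta>\<^sup>2) * p \<le> 1 - \<theta> * p"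
  "(1 - \<theta> * p)\<^sup>2 \<le> 1 - (2 * \<theta> - \<theta>\<^sup>2) * p"
  "1 - (2 * \<theta> - \<theta>\<^sup>2) * p - (1 - \<theta> * p)\<^sup>2 \<le> \<theta>\<^sup>2 * p"
proof -
  have "\<theta>\<^sup>2 \<le> \<theta>"
    using \<theta> by (simp add: power2_eq_square mult_left_le)
  then have "\<theta>\<^sup>2 * p \<le> \<theta> * p"
    using p by (intro mult_right_mono)
  then show "1 - (2 * \<theta> - \<theta>\<^sup>2) * p \<le> 1 - \<theta> * p"
    by (simp add: algebra_simps)
  have "p\<^sup>2 \<le> p"
    using p by (simp add: power2_eq_square mult_left_le)
  then have "\<theta>\<^sup>2 * p\<^sup>2 \<le> \<theta>\<^sup>2 * p"
    by (intro mult_left_mono) auto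
  then show 3: "(1 - \<theta> * p)\<^sup>2 \<le> 1 - (2 * \<theta> - \<theta>\<^sup>2) * p"
    by (simp add: power2_eq_square algebra_simps)
  show "0 \<le> 1 - (2 * \<theta> - \<theta>\<^sup>2) * p"
    using 3 zero_le_power2[of "1 - \<theta> * p"] by linarith
  have "0 \<le> \<theta>\<^sup>2 * p\<^sup>2" by simp
  then show "1 - (2 * \<theta> - \<theta>\<^sup>2) * p - (1 - \<theta> * p)\<^sup>2 \<le> \<theta>\<^sup>2 * p"
    by (simp add: power2_eq_square algebra_simps)
qed

lemma v_nonneg: "0 \<le> v"
proof -
  have "((1 - \<theta> * p)\<^sup>2) ^ m \<le> (1 - (2 * \<theta> - \<theta>\<^sup>2) * p) ^ m"
    by (intro power_mono second_moment_base) auto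
  then show ?thesis by (simp add: v_def power_mult[symmetric] mult.commute)
qed

text \<open>\<open>v\<close> is a difference of \<open>m\<close>-th powers; in its factorisation
  both bases are at most \<open>1 - \<theta> * p\<close>. The remaining power of
  \<open>1 - \<theta> * p\<close> records that heavy points are damped almost surely to
  zero.\<close>

lemma v_le: "v \<le> m * \<theta>\<^sup>2 * p * (1 - \<theta> * p) ^ (m - 1)"
proof -
  define x y where "x = 1 - (2 * \<theta> - \<theta>\<^sup>2) * p" and "y = (1 - \<theta> * p)\<^sup>2"
  have xy: "0 \<le> y" "y \<le> x" "x \<le> 1 - \<theta> * p" "x - y \<le> \<theta>\<^sup>2 * p"
    using second_moment_base by (auto simp: x_def y_def)
  obtain l where l: "m = Suc l" using m by (cases m) auto
  have "v = x ^ m - y ^ m"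
    unfolding v_def x_def y_def power_mult[symmetric] by (simp only: mult.commute)
  also have "\<dots> = (x - y) * (\<Sum>i<Suc l. x ^ i * y ^ (l - i))"
    unfolding l by (subst diff_power_eq_sum) simp
  also have "(\<Sum>i<Suc l. x ^ i * y ^ (l - i)) \<le> (\<Sum>i<Suc l. (1 - \<theta> * p) ^ l)"
  proof (rule sum_mono)
    fix i assume "i \<in> {..<Suc l}"
    then have "(1 - \<theta> * p) ^ l = (1 - \<theta> * p) ^ i * (1 - \<theta> * p) ^ (l - i)"
      by (simp flip: power_add)
    then show "x ^ i * y ^ (l - i) \<le> (1 - \<theta> * p) ^ l"
      using xy \<theta>_mult by (auto intro!: mult_mono power_mono)
  qed
  then have "(x - y) * (\<Sum>i<Suc l. x ^ i * y ^ (l - i)) \<le> (\<theta>\<^sup>2 * p) * (\<Sum>i<Suc l. (1 - \<theta> * p) ^ l)"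
    using xy p by (intro mult_mono sum_nonneg) auto
  finally show ?thesis by (simp add: l algebra_simps)
qed

lemma v_le': "a\<^sup>2 * v \<le> p / (m * w\<^sup>2)"
proof -
  have "v \<le> m * \<theta>\<^sup>2 * p * 1"
    using v_le by (rule order_trans) (use \<theta>_mult p in \<open>intro mult_left_mono power_le_one\<close>, auto)
  then have "a\<^sup>2 * v \<le> a\<^sup>2 * (m * \<theta>\<^sup>2 * p)"
    by (intro mult_left_mono) auto
  also have "\<dots> = (a * \<theta> * (m * w))\<^sup>2 * (p / (m * w\<^sup>2))"
    using w m by (simp add: field_simps power2_eq_square)
  finally show ?thesis by (simp add: a(2))
qed

text \<open>For heavy points the power in \<open>v_le\<close> beats the quadratic factor, so the
  bound does not grow with \<open>p\<close>.\<close>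

lemma p_v_le: "p * v \<le> 8 / m"
proof -
  have "m * (p * v) \<le> m * (p * (m * \<theta>\<^sup>2 * p * (1 - \<theta> * p) ^ (m - 1)))"
    using v_le p by (intro mult_left_mono) auto
  also have "\<dots> = (m * (\<theta> * p))\<^sup>2 * (1 - \<theta> * p) ^ (m - 1)"
    by (simp add: power2_eq_square)
  also have "\<dots> \<le> 8"
    by (rule square_mult_power_le) (use \<theta>_mult m in auto)
  finally show ?thesis using m by (simp add: field_simps)
qed

text \<open>Without saturation \<open>p\<close> is of order \<open>a * w\<close> at most and the
  bound \<open>v_le'\<close> suffices. With saturation \<open>\<bar>\<delta>\<bar>\<close> is at
  most \<open>p\<close>, and damping enters through \<open>p_v_le\<close>.\<close>

lemma signal_variance_le: "(a * \<delta>)\<^sup>2 * v \<le> 8 * a / m * \<kappa>"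
proof (cases "\<bar>\<delta>\<bar> / w \<le> a")
  case True
  then have \<kappa>: "\<kappa> = \<delta>\<^sup>2 / w"
    by (simp add: \<kappa>_def min_absorb2 power2_eq_square)
  have "p \<le> \<bar>\<delta>\<bar> + w" using q by (simp add: \<delta>_def)
  also have "\<dots> \<le> a * w + w" using True w by (simp add: field_simps)
  also have "\<dots> \<le> 8 * a * w"
  proof -
    have "1 * w \<le> a * w" using a(1) w by (intro mult_right_mono) auto
    moreover have "0 \<le> a * w" using a(1) w by simp
    ultimately show ?thesis by linarith
  qed
  finally have pw: "p \<le> 8 * a * w" .
  have "(a * \<delta>)\<^sup>2 * v = \<delta>\<^sup>2 * (a\<^sup>2 * v)" by (simp add: power_mult_distrib)
  also have "\<dots> \<le> \<delta>\<^sup>2 * (p / (m * w\<^sup>2))" by (intro mult_left_mono v_le') auto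
  also have "\<dots> \<le> \<delta>\<^sup>2 * (8 * a * w / (m * w\<^sup>2))"
    using pw w by (intro mult_left_mono divide_right_mono) auto
  also have "\<dots> = 8 * a / m * \<kappa>"
    using w by (simp add: \<kappa> power2_eq_square)
  finally show ?thesis .
next
  case False
  then have \<kappa>: "\<kappa> = \<bar>\<delta>\<bar> * a" by (simp add: \<kappa>_def min_absorb1)
  have "2 * w \<le> a * w" using a(1) w by (intro mult_right_mono) auto
  also have "a * w < \<bar>\<delta>\<bar>" using False w by (simp add: field_simps)
  finally have \<delta>p: "\<bar>\<delta>\<bar> \<le> p" using q w p by (auto simp: \<delta>_def abs_if split: if_splits)
  have "(a * \<delta>)\<^sup>2 * v = a * \<kappa> * (\<bar>\<delta>\<bar> * v)"
    by (simp add: \<kappa> power2_eq_square abs_mult_self_eq algebra_simps flip: abs_mult)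
  also have "\<dots> \<le> a * \<kappa> * (p * v)"
    using \<delta>p v_nonneg a(1) \<kappa>_nonneg by (intro mult_left_mono mult_right_mono) auto
  also have "\<dots> \<le> a * \<kappa> * (8 / m)"
    using p_v_le a(1) \<kappa>_nonneg by (intro mult_left_mono) auto
  finally show ?thesis by (simp add: mult_ac)
qed

section \<open>Second moment of the score at a test sample\<close>

lemma abs_\<delta>_\<mu>_le: "\<bar>\<delta>\<bar> * \<bar>\<mu>\<bar> \<le> \<kappa>"
  unfolding \<kappa>_def by (intro mult_left_mono abs_\<mu>_le) auto

lemma null_moment_le: "q * (\<mu>\<^sup>2 + a\<^sup>2 * v) \<le> \<kappa> + p / (m * w)"
proof -
  have "q * \<mu>\<^sup>2 = (q * \<bar>\<mu>\<bar>) * \<bar>\<mu>\<bar>" by (simp add: power2_eq_square)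
  also have "\<dots> \<le> (w * (\<bar>\<delta>\<bar> / w)) * \<bar>\<mu>\<bar>"
    using q w abs_\<mu>_le by (intro mult_right_mono mult_mono) auto
  also have "\<dots> \<le> \<kappa>" using abs_\<delta>_\<mu>_le w by simp
  finally have 1: "q * \<mu>\<^sup>2 \<le> \<kappa>" .
  have "q * (a\<^sup>2 * v) \<le> w * (p / (m * w\<^sup>2))"
    using q w v_le' v_nonneg by (intro mult_mono) auto
  also have "\<dots> = p / (m * w)" using w by (simp add: power2_eq_square)
  finally show ?thesis using 1 by (simp add: algebra_simps)
qed

text \<open>This pays for the mass by which \<open>p\<close> may exceed \<open>q\<close>. Without
  saturation the moment is split into squared mean and variance; with saturation the score is simply
  bounded by \<open>a\<close>.\<close>

lemma alternative_moment_le: "\<bar>\<delta>\<bar> * (\<mu>\<^sup>2 + a\<^sup>2 * v) \<le> 2 * a * \<kappa> + \<bar>\<delta>\<bar> / (m * w)"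
proof (cases "\<bar>\<delta>\<bar> / w \<le> a")
  case True
  then have \<kappa>: "\<kappa> = \<delta>\<^sup>2 / w"
    by (simp add: \<kappa>_def min_absorb2 power2_eq_square)
  have "\<bar>\<delta>\<bar> * \<mu>\<^sup>2 = (\<bar>\<delta>\<bar> * \<bar>\<mu>\<bar>) * \<bar>\<mu>\<bar>" by (simp add: power2_eq_square)
  also have "\<dots> \<le> \<kappa> * a"
    using abs_\<delta>_\<mu>_le abs_\<mu>_le \<kappa>_nonneg by (intro mult_mono) auto
  finally have 1: "\<bar>\<delta>\<bar> * \<mu>\<^sup>2 \<le> \<kappa> * a" .
  have "\<bar>\<delta>\<bar> * (a\<^sup>2 * v) \<le> \<bar>\<delta>\<bar> * (p / (m * w\<^sup>2))"
    by (intro mult_left_mono v_le') auto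
  also have "\<dots> \<le> \<bar>\<delta>\<bar> * ((w + \<bar>\<delta>\<bar>) / (m * w\<^sup>2))"
    using q by (intro mult_left_mono divide_right_mono) (auto simp: \<delta>_def)
  also have "\<dots> = \<bar>\<delta>\<bar> / (m * w) + \<kappa> * (1 / (m * w))"
    using w m by (simp add: \<kappa> power2_eq_square add_divide_distrib distrib_left abs_mult_self_eq)
  also have "\<kappa> * (1 / (m * w)) \<le> \<kappa> * a"
    using \<kappa>_nonneg by (intro mult_left_mono) (auto simp: a_def)
  finally show ?thesis using 1 by (simp add: algebra_simps)
next
  case False
  then have \<kappa>: "\<kappa> = \<bar>\<delta>\<bar> * a" by (simp add: \<kappa>_def min_absorb1)
  define c x y where "c = (1 - \<theta> * q) ^ m" and "x = (1 - \<theta> * p) ^ m"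
    and "y = (1 - (2 * \<theta> - \<theta>\<^sup>2) * p) ^ m"
  have c: "0 \<le> c" "c \<le> 1" "0 \<le> x" "x \<le> 1"
    using \<theta>_mult by (auto simp: c_def x_def power_le_one)
  have yx: "y \<le> x"
    unfolding y_def x_def by (intro power_mono second_moment_base)
  \<comment> \<open>For Z in [0, 1] with mean \<open>x\<close> and second moment \<open>y\<close>,
    the mean of (c - Z)^2 is \<open>c\<^sup>2 - 2 * c * x + y\<close>. Replacing \<open>y\<close> by
    the larger \<open>x\<close> reduces the bound 1 to an inequality in \<open>c\<close> and
    \<open>x\<close>.\<close>
  have "c * (c - 2 * x) + x \<le> 1"
  proof (cases "2 * x \<le> c")
    case True
    then have "c * (c - 2 * x) \<le> c - 2 * x" using c by (intro mult_left_le_one_le) auto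
    then have "c * (c - 2 * x) + x \<le> c - x" by simp
    then show ?thesis using c by linarith
  next
    case False
    then have "c * (c - 2 * x) \<le> 0" using c by (intro mult_nonneg_nonpos) auto
    then show ?thesis using c by linarith
  qed
  then have "c\<^sup>2 - 2 * c * x + y \<le> 1" using yx by (simp add: power2_eq_square algebra_simps)
  then have "a\<^sup>2 * (c\<^sup>2 - 2 * c * x + y) \<le> a\<^sup>2 * 1" by (intro mult_left_mono) auto
  moreover have "\<mu>\<^sup>2 + a\<^sup>2 * v = a\<^sup>2 * (c\<^sup>2 - 2 * c * x + y)"
    unfolding \<mu>_def v_def c_def[symmetric] x_def[symmetric] y_def[symmetric]
    by (simp add: power2_eq_square algebra_simps)
  ultimately have "\<bar>\<delta>\<bar> * (\<mu>\<^sup>2 + a\<^sup>2 * v) \<le> \<bar>\<delta>\<bar> * a\<^sup>2"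
    by (intro mult_left_mono) auto
  also have "\<dots> = a * \<kappa>" by (simp add: \<kappa> power2_eq_square)
  also have "\<dots> \<le> 2 * a * \<kappa> + \<bar>\<delta>\<bar> / (m * w)"
    using a(1) \<kappa>_nonneg w by (simp add: mult_right_mono)
  finally show ?thesis .
qed

text \<open>This smooth lower bound on the truncated term has the form needed for
  Cauchy-Schwarz.\<close>

lemma \<kappa>_ge: "\<delta>\<^sup>2 / (\<bar>\<delta>\<bar> + w) \<le> \<kappa>"
proof -
  have "\<bar>\<delta>\<bar> / (\<bar>\<delta>\<bar> + w) \<le> 1" using w by (simp add: field_simps)
  moreover have "\<bar>\<delta>\<bar> / (\<bar>\<delta>\<bar> + w) \<le> \<bar>\<delta>\<bar> / w" using w by (intro divide_left_mono) auto
  ultimately have "\<bar>\<delta>\<bar> * (\<bar>\<delta>\<bar> / (\<bar>\<delta>\<bar> + w)) \<le> \<kappa>"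
    unfolding \<kappa>_def using a(1) by (intro mult_left_mono) auto
  then show ?thesis by (simp add: power2_eq_square)
qed

end

subsection \<open>The score learnt from training samples\<close>

text \<open>The summand \<open>1 / n\<close> keeps the weight positive where \<open>Q\<close> has no
  mass and bounds the gain by \<open>2 + n / m\<close>; the total weight over \<open>{1..n}\<close>
  is still only 2.\<close>

definition weight :: "nat \<Rightarrow> nat pmf \<Rightarrow> nat \<Rightarrow> real" where
  "weight n Q i = pmf Q i + 1 / n"

definition damping :: "nat \<Rightarrow> nat \<Rightarrow> nat pmf \<Rightarrow> nat \<Rightarrow> real" where
  "damping n m Q i = 1 / (1 + 2 * m * weight n Q i)"

definition gain :: "nat \<Rightarrow> nat \<Rightarrow> nat pmf \<Rightarrow> nat \<Rightarrow> real" where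
  "gain n m Q i = 2 + 1 / (m * weight n Q i)"

definition score :: "nat \<Rightarrow> nat \<Rightarrow> nat pmf \<Rightarrow> nat list \<Rightarrow> nat \<Rightarrow> real" where
  "score n m Q xs i = gain n m Q i *
     ((1 - damping n m Q i * pmf Q i) ^ m - (1 - damping n m Q i) ^ count_list xs i)"

section \<open>Moments of damped counts as products over samples\<close>

lemma prod_list_map_mult:
  "prod_list (map f xs) * prod_list (map g xs) = prod_list (map (\<lambda>x. f x * g x :: real) xs)"
  by (induction xs) (auto simp: mult_ac)

lemma expectation_power_count:
  fixes t :: real
  assumes "finite (set_pmf P)"
  shows "measure_pmf.expectation (replicate_pmf m P) (\<lambda>xs. (1 - t) ^ count_list xs i)
    = (1 - t * pmf P i) ^ m"
proof -
  have "measure_pmf.expectation P (\<lambda>x. if x = i then 1 - t else 1)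
      = measure_pmf.expectation P (\<lambda>x. 1 - t * indicator {i} x)"
    by (intro Bochner_Integration.integral_cong) auto
  also have "\<dots> = 1 - t * pmf P i"
    using assms by (subst Bochner_Integration.integral_diff)
      (auto intro: integrable_measure_pmf_finite simp: measure_pmf_single)
  finally show ?thesis
    unfolding power_count_list expectation_replicate_prod[OF assms] by simp
qed

text \<open>A single sample cannot hit both \<open>i\<close> and \<open>j\<close>, so the factor of
  one sample has no cross term. This is the source of the negative correlation.\<close>

lemma expectation_power_count_mult:
  fixes t u :: real
  assumes "finite (set_pmf P)" "i \<noteq> j"
  shows "measure_pmf.expectation (replicate_pmf m P)
      (\<lambda>xs. (1 - t) ^ count_list xs i * (1 - u) ^ count_list xs j)
    = (1 - t * pmf P i - u * pmf P j) ^ m"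
proof -
  have "measure_pmf.expectation P (\<lambda>x. (if x = i then 1 - t else 1) * (if x = j then 1 - u else 1))
      = measure_pmf.expectation P (\<lambda>x. 1 - t * indicator {i} x - u * indicator {j} x)"
    using assms(2) by (intro Bochner_Integration.integral_cong) auto
  also have "\<dots> = 1 - t * pmf P i - u * pmf P j"
    by (simp add: measure_pmf_single integrable_measure_pmf_finite[OF assms(1)])
  finally show ?thesis
    unfolding power_count_list prod_list_map_mult expectation_replicate_prod[OF assms(1)] by simp
qed

text \<open>Chebyshev's inequality.\<close>

lemma prob_deviation_le:
  fixes f :: "'a \<Rightarrow> real"
  assumes "finite (set_pmf M)" "0 < t"
    and "measure_pmf.expectation M (\<lambda>x. (f x - c)\<^sup>2) \<le> V"
  shows "measure_pmf.prob M {x. t \<le> \<bar>f x - c\<bar>} \<le> V / t\<^sup>2"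
proof -
  have "{x. t \<le> \<bar>f x - c\<bar>} = {x. t\<^sup>2 \<le> (f x - c)\<^sup>2}"
    using assms(2) by (auto simp: abs_le_square_iff[symmetric])
  then have "measure_pmf.prob M {x. t \<le> \<bar>f x - c\<bar>} \<le> measure_pmf.expectation M (\<lambda>x. (f x - c)\<^sup>2) / t\<^sup>2"
    using prob_ge_le_expectation[OF assms(1), of "\<lambda>x. (f x - c)\<^sup>2" "t\<^sup>2"] assms(2) by simp
  also have "\<dots> \<le> V / t\<^sup>2"
    using assms(3) by (intro divide_right_mono) auto
  finally show ?thesis .
qed

lemma negatively_correlated_nonneg:
  fixes U :: "'i \<Rightarrow> 'a \<Rightarrow> real"
  assumes "finite (set_pmf M)" "finite S" "\<And>i. i \<in> S \<Longrightarrow> 0 \<le> c i"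
    and neg: "\<And>i j. i \<in> S \<Longrightarrow> j \<in> S \<Longrightarrow> i \<noteq> j \<Longrightarrow> measure_pmf.expectation M (\<lambda>x. U i x * U j x) \<le> 0"
  shows "measure_pmf.expectation M (\<lambda>x. (\<Sum>i\<in>S. c i * U i x)\<^sup>2)
    \<le> (\<Sum>i\<in>S. (c i)\<^sup>2 * measure_pmf.expectation M (\<lambda>x. (U i x)\<^sup>2))"
proof -
  have "measure_pmf.expectation M (\<lambda>x. (\<Sum>i\<in>S. c i * U i x)\<^sup>2)
      = (\<Sum>i\<in>S. \<Sum>j\<in>S. (c i * c j) * measure_pmf.expectation M (\<lambda>x. U i x * U j x))"
    by (simp add: power2_eq_square sum_product Bochner_Integration.integral_sum
        integrable_measure_pmf_finite[OF assms(1)] mult_ac)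
  also have "\<dots> \<le> (\<Sum>i\<in>S. \<Sum>j\<in>S. if i = j then (c i)\<^sup>2 * measure_pmf.expectation M (\<lambda>x. (U i x)\<^sup>2) else 0)"
    using assms(3) neg
    by (intro sum_mono) (auto simp: power2_eq_square intro!: mult_nonneg_nonpos)
  also have "\<dots> = (\<Sum>i\<in>S. (c i)\<^sup>2 * measure_pmf.expectation M (\<lambda>x. (U i x)\<^sup>2))"
    using assms(2) by simp
  finally show ?thesis .
qed

text \<open>Negative correlation is only useful for coefficients of one sign, hence the factor 2.\<close>
lemma negatively_correlated:
  fixes U :: "'i \<Rightarrow> 'a \<Rightarrow> real"
  assumes M: "finite (set_pmf M)" and S: "finite S"
    and neg: "\<And>i j. i \<in> S \<Longrightarrow> j \<in> S \<Longrightarrow> i \<noteq> j \<Longrightarrow> measure_pmf.expectation M (\<lambda>x. U i x * U j x) \<le> 0"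
  shows "measure_pmf.expectation M (\<lambda>x. (\<Sum>i\<in>S. c i * U i x)\<^sup>2)
    \<le> 2 * (\<Sum>i\<in>S. (c i)\<^sup>2 * measure_pmf.expectation M (\<lambda>x. (U i x)\<^sup>2))"
proof -
  note int = integrable_measure_pmf_finite[OF M]
  define A B where "A x = (\<Sum>i\<in>S. max 0 (c i) * U i x)" and "B x = (\<Sum>i\<in>S. max 0 (- c i) * U i x)" for x
  have "(\<Sum>i\<in>S. c i * U i x) = A x - B x" for x
    unfolding A_def B_def sum_subtractf[symmetric]
    by (intro sum.cong) (auto simp: max_def algebra_simps)
  moreover have "(y - z)\<^sup>2 \<le> 2 * y\<^sup>2 + 2 * z\<^sup>2" for y z :: real
    using zero_le_power2[of "y + z"] by (simp add: power2_eq_square algebra_simps)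
  ultimately have "measure_pmf.expectation M (\<lambda>x. (\<Sum>i\<in>S. c i * U i x)\<^sup>2)
      \<le> measure_pmf.expectation M (\<lambda>x. 2 * (A x)\<^sup>2 + 2 * (B x)\<^sup>2)"
    by (intro integral_mono int) auto
  also have "\<dots> = 2 * (measure_pmf.expectation M (\<lambda>x. (A x)\<^sup>2) + measure_pmf.expectation M (\<lambda>x. (B x)\<^sup>2))"
    by (simp add: int)
  also have "\<dots> \<le> 2 * ((\<Sum>i\<in>S. (max 0 (c i))\<^sup>2 * measure_pmf.expectation M (\<lambda>x. (U i x)\<^sup>2))
      + (\<Sum>i\<in>S. (max 0 (- c i))\<^sup>2 * measure_pmf.expectation M (\<lambda>x. (U i x)\<^sup>2)))"
    unfolding A_def B_def
    by (intro mult_left_mono add_mono negatively_correlated_nonneg M S neg) auto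
  also have "\<dots> = 2 * (\<Sum>i\<in>S. (c i)\<^sup>2 * measure_pmf.expectation M (\<lambda>x. (U i x)\<^sup>2))"
    unfolding sum.distrib[symmetric]
    by (intro arg_cong[of _ _ "(*) 2"] sum.cong) (auto simp: max_def)
  finally show ?thesis .
qed

section \<open>Expectations and total variation distance as finite sums\<close>

lemma expectation_sum_upto:
  fixes f :: "nat \<Rightarrow> real"
  assumes "set_pmf M \<subseteq> {1..n}"
  shows "measure_pmf.expectation M f = (\<Sum>i=1..n. pmf M i * f i)"
  using assms by (subst integral_measure_pmf[of "{1..n}"]) auto

lemma d_TV_le_sum:
  fixes P Q :: "nat pmf"
  assumes "set_pmf P \<subseteq> {1..n}" "set_pmf Q \<subseteq> {1..n}"
  shows "d_TV P Q \<le> (\<Sum>i=1..n. \<bar>pmf P i - pmf Q i\<bar>)"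
  unfolding d_TV_def
proof (rule cSUP_least)
  fix A :: "nat set"
  have "measure_pmf.prob P A - measure_pmf.prob Q A
    = measure_pmf.expectation P (indicator A) - measure_pmf.expectation Q (indicator A)"
    by simp
  also have "\<dots> = (\<Sum>i=1..n. (pmf P i - pmf Q i) * indicator A i)"
    using assms
    by (simp add: expectation_sum_upto left_diff_distrib sum_subtractf del: Bochner_Integration.integral_indicator)
  finally have "\<bar>measure_pmf.prob P A - measure_pmf.prob Q A\<bar>
    \<le> (\<Sum>i=1..n. \<bar>(pmf P i - pmf Q i) * indicator A i\<bar>)"
    by (simp only: sum_abs)
  also have "\<dots> \<le> (\<Sum>i=1..n. \<bar>pmf P i - pmf Q i\<bar>)"
    by (intro sum_mono) (auto simp: indicator_def)
  finally show "\<bar>measure_pmf.prob P A - measure_pmf.prob Q A\<bar> \<le> (\<Sum>i=1..n. \<bar>pmf P i - pmf Q i\<bar>)" .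
qed simp

section \<open>Training on samples of the unknown distribution\<close>

locale training =
  fixes n m :: nat and P Q :: "nat pmf"
  assumes n: "1 \<le> n" and m: "1 \<le> m"
    and P: "set_pmf P \<subseteq> {1..n}" and Q: "set_pmf Q \<subseteq> {1..n}"
begin

abbreviation "w \<equiv> weight n Q"
abbreviation "\<theta> \<equiv> damping n m Q"
abbreviation "a \<equiv> gain n m Q"
abbreviation "f \<equiv> score n m Q"
abbreviation "R \<equiv> replicate_pmf m P"
abbreviation "\<delta> i \<equiv> point.\<delta> (pmf P i) (pmf Q i)"
abbreviation "\<mu> i \<equiv> point.\<mu> m (pmf P i) (pmf Q i) (\<theta> i) (a i)"
abbreviation "v i \<equiv> point.v m (pmf P i) (\<theta> i)"
abbreviation "\<kappa> i \<equiv> point.\<kappa> (pmf P i) (pmf Q i) (w i) (a i)"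

definition "K = (\<Sum>i=1..n. \<kappa> i)"

lemma finP: "finite (set_pmf P)" and finQ: "finite (set_pmf Q)"
  using P Q finite_subset by blast+

lemma finR: "finite (set_pmf R)"
  by (rule finite_set_replicate_pmf[OF finP])

lemmas intR = integrable_measure_pmf_finite[OF finR]

lemma point: "point m (pmf P i) (pmf Q i) (w i) (\<theta> i) (a i)"
  using n m by unfold_locales
    (auto simp: weight_def damping_def gain_def pmf_le_1 intro: add_nonneg_pos)

lemma weight_ge: "1 / n \<le> w i" "0 < w i"
  using n by (auto simp: weight_def intro: add_nonneg_pos)

lemma inverse_weight_le: "1 / (m * w i) \<le> n / m"
proof -
  have "1 / w i \<le> 1 / (1 / n)"
    using n weight_ge by (intro divide_left_mono) auto
  then show ?thesis
    using m by (simp add: field_simps)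
qed

lemma gain_le: "a i \<le> 2 + n / m"
  using inverse_weight_le[of i] by (simp add: gain_def)

lemma sum_P: "(\<Sum>i=1..n. pmf P i) = 1" and sum_Q: "(\<Sum>i=1..n. pmf Q i) = 1"
  using P Q by (auto intro: sum_pmf_eq_1)

lemma sum_abs_\<delta>_le: "(\<Sum>i=1..n. \<bar>\<delta> i\<bar>) \<le> 2"
proof -
  have "(\<Sum>i=1..n. \<bar>\<delta> i\<bar>) \<le> (\<Sum>i=1..n. pmf P i + pmf Q i)"
    by (intro sum_mono) (auto simp: point.\<delta>_def[OF point] abs_le_iff add_increasing add_increasing2)
  then show ?thesis by (simp add: sum.distrib sum_P sum_Q del: One_nat_def)
qed

lemma expectation_score: "measure_pmf.expectation R (\<lambda>xs. f xs i) = \<mu> i"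
  using expectation_power_count[OF finP, of m "\<theta> i" i]
  by (simp add: score_def point.\<mu>_def[OF point] intR)

lemma expectation_damped_square:
  "measure_pmf.expectation R (\<lambda>xs. ((1 - \<theta> i) ^ count_list xs i)\<^sup>2) = (1 - (2 * \<theta> i - (\<theta> i)\<^sup>2) * pmf P i) ^ m"
proof -
  have "((1 - \<theta> i) ^ c)\<^sup>2 = (1 - (2 * \<theta> i - (\<theta> i)\<^sup>2)) ^ c" for c
  proof -
    have "((1 - \<theta> i) ^ c)\<^sup>2 = ((1 - \<theta> i)\<^sup>2) ^ c"
      by (simp only: power_mult[symmetric] mult.commute)
    also have "(1 - \<theta> i)\<^sup>2 = 1 - (2 * \<theta> i - (\<theta> i)\<^sup>2)"
      by (simp add: power2_diff)
    finally show ?thesis .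
  qed
  then show ?thesis
    using expectation_power_count[OF finP, of m "2 * \<theta> i - (\<theta> i)\<^sup>2" i] by simp
qed

lemma expectation_score_square: "measure_pmf.expectation R (\<lambda>xs. (f xs i)\<^sup>2) = (\<mu> i)\<^sup>2 + (a i)\<^sup>2 * v i"
proof -
  let ?c = "(1 - \<theta> i * pmf Q i) ^ m"
  have "(\<lambda>xs. (f xs i)\<^sup>2) = (\<lambda>xs. (a i)\<^sup>2 * (?c\<^sup>2 - (2 * ?c) * (1 - \<theta> i) ^ count_list xs i
      + ((1 - \<theta> i) ^ count_list xs i)\<^sup>2))"
    by (simp add: score_def power2_eq_square algebra_simps)
  then have "measure_pmf.expectation R (\<lambda>xs. (f xs i)\<^sup>2) = (a i)\<^sup>2 * (?c\<^sup>2 - (2 * ?c) * (1 - \<theta> i * pmf P i) ^ m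
      + (1 - (2 * \<theta> i - (\<theta> i)\<^sup>2) * pmf P i) ^ m)"
    using expectation_damped_square[of i] expectation_power_count[OF finP, of m "\<theta> i" i]
    by (simp add: intR)
  also have "\<dots> = (\<mu> i)\<^sup>2 + (a i)\<^sup>2 * v i"
    unfolding point.\<mu>_def[OF point] point.v_def[OF point]
    by (simp add: power2_eq_square algebra_simps)
  finally show ?thesis .
qed

lemma K_nonneg: "0 \<le> K"
  unfolding K_def by (intro sum_nonneg point.\<kappa>_nonneg[OF point])

text \<open>Cauchy-Schwarz with the weights \<open>\<bar>\<delta> i\<bar> + w i\<close>, whose total
  is at most 2 + 2 = 4.\<close>

lemma K_ge:
  assumes "0 \<le> \<epsilon>" "\<epsilon> \<le> d_TV P Q"
  shows "\<epsilon>\<^sup>2 / 4 \<le> K"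
proof -
  have "\<epsilon> \<le> (\<Sum>i=1..n. \<bar>\<delta> i\<bar>)"
    using assms d_TV_le_sum[OF P Q] by (simp add: point.\<delta>_def[OF point])
  then have "\<epsilon>\<^sup>2 \<le> (\<Sum>i=1..n. \<bar>\<delta> i\<bar>)\<^sup>2"
    using assms by (intro power_mono)
  also have "(\<Sum>i=1..n. \<bar>\<delta> i\<bar>) = (\<Sum>i=1..n. (\<bar>\<delta> i\<bar> / sqrt (\<bar>\<delta> i\<bar> + w i)) * sqrt (\<bar>\<delta> i\<bar> + w i))"
  proof (intro sum.cong)
    fix i
    have "0 < \<bar>\<delta> i\<bar> + w i" using weight_ge by (intro add_nonneg_pos) auto
    then show "\<bar>\<delta> i\<bar> = (\<bar>\<delta> i\<bar> / sqrt (\<bar>\<delta> i\<bar> + w i)) * sqrt (\<bar>\<delta> i\<bar> + w i)" by simp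
  qed simp
  also have "\<dots>\<^sup>2 \<le> (\<Sum>i=1..n. (\<bar>\<delta> i\<bar> / sqrt (\<bar>\<delta> i\<bar> + w i))\<^sup>2) * (\<Sum>i=1..n. (sqrt (\<bar>\<delta> i\<bar> + w i))\<^sup>2)"
    by (rule Cauchy_Schwarz_ineq_sum)
  also have "\<dots> = (\<Sum>i=1..n. (\<delta> i)\<^sup>2 / (\<bar>\<delta> i\<bar> + w i)) * (\<Sum>i=1..n. \<bar>\<delta> i\<bar> + w i)"
    using weight_ge(2) by (simp add: power_divide less_imp_le)
  also have "\<dots> \<le> K * 4"
  proof (rule mult_mono)
    show "(\<Sum>i=1..n. (\<delta> i)\<^sup>2 / (\<bar>\<delta> i\<bar> + w i)) \<le> K"
      unfolding K_def by (intro sum_mono point.\<kappa>_ge[OF point])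
    have "(\<Sum>i=1..n. w i) = 2"
      using n sum_Q by (simp add: weight_def sum.distrib)
    then show "(\<Sum>i=1..n. \<bar>\<delta> i\<bar> + w i) \<le> 4"
      using sum_abs_\<delta>_le by (simp add: sum.distrib)
    show "0 \<le> (\<Sum>i=1..n. \<bar>\<delta> i\<bar> + w i)"
      using weight_ge(2) by (intro sum_nonneg add_nonneg_nonneg) (auto simp: less_imp_le)
  qed (rule K_nonneg)
  finally show ?thesis by simp
qed

text \<open>By \<open>signal_eq\<close> this is the gap between the mean scores of a test sample
  from \<open>P\<close> and one from \<open>Q\<close>, once the training set \<open>xs\<close> is
  fixed.\<close>

definition "signal xs = (\<Sum>i=1..n. \<delta> i * f xs i)"

lemma signal_eq: "signal xs = measure_pmf.expectation P (f xs) - measure_pmf.expectation Q (f xs)"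
  by (simp add: signal_def expectation_sum_upto[OF P] expectation_sum_upto[OF Q]
      point.\<delta>_def[OF point] left_diff_distrib sum_subtractf)

lemma expectation_signal_ge: "K / 4 \<le> measure_pmf.expectation R signal"
proof -
  have "K / 4 \<le> (\<Sum>i=1..n. \<delta> i * \<mu> i)"
    unfolding K_def sum_divide_distrib by (intro sum_mono point.\<delta>_\<mu>_ge[OF point])
  also have "\<dots> = measure_pmf.expectation R signal"
    unfolding signal_def by (simp add: Bochner_Integration.integral_sum intR expectation_score)
  finally show ?thesis .
qed

text \<open>The signal is a linear combination of the centred damped counts \<open>U i\<close>, so
  negative correlation reduces its variance to the bounds at single points. The coefficients have
  both signs, which gives 16 = 2 * 8.\<close>

lemma variance_signal_le:
  "measure_pmf.expectation R (\<lambda>xs. (signal xs - measure_pmf.expectation R signal)\<^sup>2) \<le> 16 * (2 + n / m) / m * K"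
proof -
  define E where "E i = (1 - \<theta> i * pmf P i) ^ m" for i
  define U where "U i xs = (1 - \<theta> i) ^ count_list xs i - E i" for i xs
  have EZ: "measure_pmf.expectation R (\<lambda>xs. (1 - \<theta> i) ^ count_list xs i) = E i" for i
    unfolding E_def by (rule expectation_power_count[OF finP])
  have neg: "measure_pmf.expectation R (\<lambda>xs. U i xs * U j xs) \<le> 0" if "i \<noteq> j" for i j
  proof -
    have "(\<lambda>xs. U i xs * U j xs) = (\<lambda>xs. (1 - \<theta> i) ^ count_list xs i * (1 - \<theta> j) ^ count_list xs j
        - E j * (1 - \<theta> i) ^ count_list xs i - E i * (1 - \<theta> j) ^ count_list xs j + E i * E j)"
      by (auto simp: U_def algebra_simps)
    then have "measure_pmf.expectation R (\<lambda>xs. U i xs * U j xs)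
        = (1 - \<theta> i * pmf P i - \<theta> j * pmf P j) ^ m - E i * E j"
      by (simp add: intR EZ expectation_power_count_mult[OF finP that])
    \<comment> \<open>Negative correlation is the inequality 1 - x - y <= (1 - x) (1 - y) raised to
      the power \<open>m\<close>; the left base is nonnegative because the two masses sum to at most
      1.\<close>
    moreover have "(1 - \<theta> i * pmf P i - \<theta> j * pmf P j) ^ m \<le> ((1 - \<theta> i * pmf P i) * (1 - \<theta> j * pmf P j)) ^ m"
    proof (rule power_mono)
      have "pmf P i + pmf P j = measure_pmf.prob P {i, j}"
        using that by (simp add: measure_measure_pmf_finite)
      also have "\<dots> \<le> 1" by simp
      finally have "pmf P i + pmf P j \<le> 1" .
      moreover have "\<theta> l * pmf P l \<le> 1 * pmf P l" for l
        using point.\<theta>[OF point, of l] by (intro mult_right_mono) auto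
      ultimately show "0 \<le> 1 - \<theta> i * pmf P i - \<theta> j * pmf P j"
        by (smt (verit) mult_1)
      have "0 \<le> (\<theta> i * pmf P i) * (\<theta> j * pmf P j)"
        by (intro mult_nonneg_nonneg point.\<theta>_mult[OF point])
      then show "1 - \<theta> i * pmf P i - \<theta> j * pmf P j \<le> (1 - \<theta> i * pmf P i) * (1 - \<theta> j * pmf P j)"
        by (simp add: algebra_simps)
    qed
    ultimately show ?thesis by (simp add: E_def power_mult_distrib)
  qed
  have sq: "measure_pmf.expectation R (\<lambda>xs. (U i xs)\<^sup>2) = v i" for i
  proof -
    have "(\<lambda>xs. (U i xs)\<^sup>2) = (\<lambda>xs. ((1 - \<theta> i) ^ count_list xs i)\<^sup>2
        - (2 * E i) * (1 - \<theta> i) ^ count_list xs i + (E i)\<^sup>2)"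
      by (auto simp: U_def power2_diff algebra_simps)
    then show ?thesis
      unfolding point.v_def[OF point]
      by (simp add: intR EZ expectation_damped_square) (simp add: E_def power2_eq_square)
  qed
  have "signal xs - measure_pmf.expectation R signal = (\<Sum>i=1..n. - (a i * \<delta> i) * U i xs)" for xs
    unfolding signal_def
    by (simp add: Bochner_Integration.integral_sum intR expectation_score flip: sum_subtractf)
      (simp add: score_def point.\<mu>_def[OF point] U_def E_def algebra_simps)
  then have "measure_pmf.expectation R (\<lambda>xs. (signal xs - measure_pmf.expectation R signal)\<^sup>2)
      \<le> 2 * (\<Sum>i=1..n. (- (a i * \<delta> i))\<^sup>2 * v i)"
    using negatively_correlated[OF finR, of "{1..n}" U "\<lambda>i. - (a i * \<delta> i)"] neg sq by simp
  also have "\<dots> \<le> 2 * (\<Sum>i=1..n. 8 * (2 + n / m) / m * \<kappa> i)"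
  proof (intro mult_left_mono sum_mono)
    fix i
    have "(- (a i * \<delta> i))\<^sup>2 * v i \<le> 8 * a i / m * \<kappa> i"
      using point.signal_variance_le[OF point] by simp
    also have "\<dots> \<le> 8 * (2 + n / m) / m * \<kappa> i"
      using gain_le
      by (intro mult_right_mono mult_left_mono point.\<kappa>_nonneg[OF point] divide_right_mono) auto
    finally show "(- (a i * \<delta> i))\<^sup>2 * v i \<le> 8 * (2 + n / m) / m * \<kappa> i" .
  qed simp
  also have "\<dots> = 16 * (2 + n / m) / m * K"
    unfolding K_def sum_distrib_left[symmetric] by simp
  finally show ?thesis .
qed

lemma sum_score_square:
  "measure_pmf.expectation R (\<lambda>xs. \<Sum>i=1..n. c i * (f xs i)\<^sup>2) = (\<Sum>i=1..n. c i * ((\<mu> i)\<^sup>2 + (a i)\<^sup>2 * v i))"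
  by (simp add: Bochner_Integration.integral_sum intR expectation_score_square)

lemma null_second_moment_le:
  "measure_pmf.expectation R (\<lambda>xs. measure_pmf.expectation Q (\<lambda>x. (f xs x)\<^sup>2)) \<le> K + n / m"
proof -
  have "(\<Sum>i=1..n. pmf Q i * ((\<mu> i)\<^sup>2 + (a i)\<^sup>2 * v i)) \<le> (\<Sum>i=1..n. \<kappa> i + pmf P i * (n / m))"
  proof (rule sum_mono)
    fix i
    have "pmf P i * (1 / (m * w i)) \<le> pmf P i * (n / m)"
      by (intro mult_left_mono inverse_weight_le) auto
    then show "pmf Q i * ((\<mu> i)\<^sup>2 + (a i)\<^sup>2 * v i) \<le> \<kappa> i + pmf P i * (n / m)"
      using point.null_moment_le[OF point, of i] by simp
  qed
  also have "\<dots> = K + n / m"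
    unfolding sum.distrib K_def sum_distrib_right[symmetric] sum_P by simp
  finally show ?thesis
    by (simp only: expectation_sum_upto[OF Q] sum_score_square)
qed

text \<open>The mass of \<open>P\<close> is at most that of \<open>Q\<close> plus
  \<open>\<bar>\<delta> i\<bar>\<close>, so the null bound is reused and only the excess is added.
  The coefficients arise as 5 = 1 + 4 and 3 = 1 + 2.\<close>

lemma alternative_second_moment_le:
  "measure_pmf.expectation R (\<lambda>xs. measure_pmf.expectation P (\<lambda>x. (f xs x)\<^sup>2))
    \<le> 5 * K + 2 * (n / m) * K + 3 * (n / m)"
proof -
  have "(\<Sum>i=1..n. pmf P i * ((\<mu> i)\<^sup>2 + (a i)\<^sup>2 * v i))
      \<le> (\<Sum>i=1..n. pmf Q i * ((\<mu> i)\<^sup>2 + (a i)\<^sup>2 * v i) + (2 * (2 + n / m) * \<kappa> i + \<bar>\<delta> i\<bar> * (n / m)))"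
  proof (rule sum_mono)
    fix i
    have "pmf P i * ((\<mu> i)\<^sup>2 + (a i)\<^sup>2 * v i) \<le> (pmf Q i + \<bar>\<delta> i\<bar>) * ((\<mu> i)\<^sup>2 + (a i)\<^sup>2 * v i)"
      using point.v_nonneg[OF point]
      by (intro mult_right_mono) (auto simp: point.\<delta>_def[OF point])
    moreover have "\<bar>\<delta> i\<bar> * ((\<mu> i)\<^sup>2 + (a i)\<^sup>2 * v i) \<le> 2 * (2 + n / m) * \<kappa> i + \<bar>\<delta> i\<bar> * (n / m)"
    proof -
      have "\<bar>\<delta> i\<bar> * ((\<mu> i)\<^sup>2 + (a i)\<^sup>2 * v i) \<le> 2 * a i * \<kappa> i + \<bar>\<delta> i\<bar> * (1 / (m * w i))"
        using point.alternative_moment_le[OF point, of i] by simp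
      also have "\<dots> \<le> 2 * (2 + n / m) * \<kappa> i + \<bar>\<delta> i\<bar> * (n / m)"
        using gain_le
        by (intro add_mono mult_right_mono mult_left_mono inverse_weight_le point.\<kappa>_nonneg[OF point]) auto
      finally show ?thesis .
    qed
    ultimately show "pmf P i * ((\<mu> i)\<^sup>2 + (a i)\<^sup>2 * v i)
        \<le> pmf Q i * ((\<mu> i)\<^sup>2 + (a i)\<^sup>2 * v i) + (2 * (2 + n / m) * \<kappa> i + \<bar>\<delta> i\<bar> * (n / m))"
      unfolding distrib_right by linarith
  qed
  also have "\<dots> = (\<Sum>i=1..n. pmf Q i * ((\<mu> i)\<^sup>2 + (a i)\<^sup>2 * v i)) + (2 * (2 + n / m) * K + (\<Sum>i=1..n. \<bar>\<delta> i\<bar>) * (n / m))"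
    by (simp only: sum.distrib K_def sum_distrib_left sum_distrib_right)
  also have "\<dots> \<le> (K + n / m) + (2 * (2 + n / m) * K + 2 * (n / m))"
  proof (intro add_mono mult_right_mono order_refl sum_abs_\<delta>_le)
    show "(\<Sum>i=1..n. pmf Q i * ((\<mu> i)\<^sup>2 + (a i)\<^sup>2 * v i)) \<le> K + n / m"
      using null_second_moment_le by (simp only: expectation_sum_upto[OF Q] sum_score_square)
  qed (simp_all add: K_nonneg)
  also have "\<dots> = 5 * K + 2 * (n / m) * K + 3 * (n / m)"
    by (simp add: algebra_simps)
  finally show ?thesis
    by (simp only: expectation_sum_upto[OF P] sum_score_square)
qed

end

lemma variance_sum_list_le:
  fixes g :: "'a \<Rightarrow> real"
  assumes fin: "finite (set_pmf M)"
  shows "measure_pmf.expectation (replicate_pmf s M)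
      (\<lambda>ys. (sum_list (map g ys) - s * measure_pmf.expectation M g)\<^sup>2)
    \<le> s * measure_pmf.expectation M (\<lambda>x. (g x)\<^sup>2)"
proof -
  note int = integrable_measure_pmf_finite[OF fin]
  let ?e = "measure_pmf.expectation M g"
  define h where "h x = g x - ?e" for x
  have sum_h: "sum_list (map h ys) = sum_list (map g ys) - length ys * ?e" for ys
    by (induction ys) (simp_all add: h_def algebra_simps)
  have "measure_pmf.expectation M h = 0"
    by (simp add: h_def[abs_def] int)
  then have "measure_pmf.expectation (replicate_pmf s M) (\<lambda>ys. (sum_list (map h ys))\<^sup>2)
      = s * measure_pmf.expectation M (\<lambda>x. (h x)\<^sup>2)"
    by (rule variance_replicate_sum(2)[OF fin])
  moreover have "measure_pmf.expectation (replicate_pmf s M) (\<lambda>ys. (sum_list (map h ys))\<^sup>2)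
      = measure_pmf.expectation (replicate_pmf s M) (\<lambda>ys. (sum_list (map g ys) - s * ?e)\<^sup>2)"
    by (intro integral_cong_AE) (auto simp: AE_measure_pmf_iff set_replicate_pmf sum_h)
  moreover have "measure_pmf.expectation M (\<lambda>x. (h x)\<^sup>2) = measure_pmf.expectation M (\<lambda>x. (g x)\<^sup>2) - ?e\<^sup>2"
  proof -
    have "(\<lambda>x. (h x)\<^sup>2) = (\<lambda>x. (g x)\<^sup>2 - (2 * ?e) * g x + ?e\<^sup>2)"
      by (auto simp: h_def power2_diff)
    then show ?thesis by (simp add: int power2_eq_square)
  qed
  ultimately show ?thesis
    by (simp add: mult_left_mono)
qed

subsection \<open>Detecting the unknown distribution\<close>

text \<open>The last summand of the threshold only keeps it positive when the score vanishes
  on the support of \<open>Q\<close>.\<close>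
definition detect :: "nat \<Rightarrow> nat \<Rightarrow> nat \<Rightarrow> real \<Rightarrow> nat pmf \<Rightarrow> nat list \<Rightarrow> nat list \<Rightarrow> bool" where
  "detect n m s \<epsilon> Q xs ys \<longleftrightarrow>
    s * measure_pmf.expectation Q (score n m Q xs)
      + (sqrt (20 * (s * measure_pmf.expectation Q (\<lambda>x. (score n m Q xs x)\<^sup>2))) + s * \<epsilon>\<^sup>2 / 128)
    < sum_list (map (score n m Q xs) ys)"

text \<open>The threshold is built from the second moment of the score under \<open>Q\<close>
  itself, so Chebyshev's inequality applies for every training set \<open>xs\<close>. The 20 in the
  threshold is the inverse of the error.\<close>

lemma detect_null:
  assumes "finite (set_pmf Q)" "1 \<le> s" "0 < \<epsilon>"
  shows "measure_pmf.prob (replicate_pmf s Q) {ys. detect n m s \<epsilon> Q xs ys} \<le> 1 / 20"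
proof -
  let ?f = "score n m Q xs"
  define V where "V = s * measure_pmf.expectation Q (\<lambda>x. (?f x)\<^sup>2)"
  define \<tau> where "\<tau> = sqrt (20 * V) + s * \<epsilon>\<^sup>2 / 128"
  have V: "0 \<le> V" unfolding V_def by (intro mult_nonneg_nonneg integral_nonneg_AE) auto
  have \<eta>: "0 < s * \<epsilon>\<^sup>2 / 128" using assms by simp
  then have \<tau>: "0 < \<tau>" using V unfolding \<tau>_def by (intro add_nonneg_pos) auto
  have "20 * V = (sqrt (20 * V))\<^sup>2" using V by simp
  also have "\<dots> \<le> \<tau>\<^sup>2" using V \<eta> unfolding \<tau>_def by (intro power_mono) auto
  finally have V\<tau>: "20 * V \<le> \<tau>\<^sup>2" .
  have "measure_pmf.prob (replicate_pmf s Q) {ys. detect n m s \<epsilon> Q xs ys}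
      \<le> measure_pmf.prob (replicate_pmf s Q) {ys. \<tau> \<le> \<bar>sum_list (map ?f ys) - s * measure_pmf.expectation Q ?f\<bar>}"
    by (intro measure_pmf.finite_measure_mono) (auto simp: detect_def \<tau>_def V_def)
  also have "\<dots> \<le> V / \<tau>\<^sup>2"
    using variance_sum_list_le[OF assms(1), of s ?f] \<tau>
    by (intro prob_deviation_le finite_set_replicate_pmf assms) (auto simp: V_def)
  also have "\<dots> \<le> 1 / 20" using \<tau> V\<tau> by (simp add: field_simps)
  finally show ?thesis .
qed

context training
begin

text \<open>Three bad events of probability 1/60 each: Chebyshev for the signal, whose mean is at
  least \<open>K / 4\<close>, falling below \<open>K / 8\<close>, and Markov with factor 60 for the
  two second moments.\<close>

lemma good_training:
  assumes \<epsilon>: "0 < \<epsilon>" "\<epsilon> \<le> 1" "\<epsilon> \<le> d_TV P Q"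
    and mge: "10 ^ 8 * sqrt n / \<epsilon>\<^sup>2 \<le> m"
  defines "VQ \<equiv> \<lambda>xs. measure_pmf.expectation Q (\<lambda>x. (f xs x)\<^sup>2)"
    and "VP \<equiv> \<lambda>xs. measure_pmf.expectation P (\<lambda>x. (f xs x)\<^sup>2)"
  shows "1 - 1 / 20 \<le> measure_pmf.prob R {xs. K / 8 \<le> signal xs \<and>
    VQ xs \<le> 60 * (K + n / m) \<and> VP xs \<le> 60 * (5 * K + 2 * (n / m) * K + 3 * (n / m))}"
proof -
  have K: "\<epsilon>\<^sup>2 / 4 \<le> K" using K_ge \<epsilon> by simp
  have K0: "0 < K" using K \<epsilon> by (smt (verit) zero_less_power divide_pos_pos)
  have e2: "0 < \<epsilon>\<^sup>2" "\<epsilon>\<^sup>2 \<le> 1" using \<epsilon> by (auto simp: power_le_one)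
  have nm: "0 < n / m" using n m by simp
  define b1 where "b1 = {xs. K / 8 \<le> \<bar>signal xs - measure_pmf.expectation R signal\<bar>}"
  define b2 where "b2 = {xs. 60 * (K + n / m) \<le> VQ xs}"
  define b3 where "b3 = {xs. 60 * (5 * K + 2 * (n / m) * K + 3 * (n / m)) \<le> VP xs}"
  have "measure_pmf.prob R b1 \<le> 16 * (2 + n / m) / m * K / (K / 8)\<^sup>2"
    unfolding b1_def using K0 by (intro prob_deviation_le finR variance_signal_le) auto
  \<comment> \<open>The claim amounts to \<open>61440 * (2 + n / m) \<le> m * K\<close> with 61440 =
    60 * 1024. It follows from \<open>K_ge\<close>, since \<open>m * \<epsilon>\<^sup>2\<close>
    dominates both 1 and \<open>n / m\<close>.\<close>
  also have "\<dots> \<le> 1 / 60"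
  proof -
    have sn: "1 \<le> sqrt n" using n by simp
    have me: "10 ^ 8 * sqrt n \<le> m * \<epsilon>\<^sup>2" using mge e2 by (simp add: field_simps)
    have 1: "10 ^ 8 \<le> m * \<epsilon>\<^sup>2"
      by (rule order_trans[OF _ me]) (use sn in simp)
    have "(10 ^ 8 * sqrt n) * (10 ^ 8 * sqrt n) \<le> (m * \<epsilon>\<^sup>2) * (m * \<epsilon>\<^sup>2)"
      by (rule mult_mono[OF me me]) simp_all
    moreover have "(10 ^ 8 * sqrt n) * (10 ^ 8 * sqrt n) = 10 ^ 16 * (sqrt n * sqrt n)" by simp
    ultimately have "10 ^ 16 * real n \<le> (m * \<epsilon>\<^sup>2) * (m * \<epsilon>\<^sup>2)"
      by (simp only: real_sqrt_mult_self abs_of_nat)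
    also have "\<dots> \<le> (m * \<epsilon>\<^sup>2) * (m * 1)"
      by (rule mult_left_mono) (use e2 in \<open>auto simp: mult_left_le\<close>)
    finally have 2: "10 ^ 16 * (n / m) \<le> m * \<epsilon>\<^sup>2"
      using m by (simp add: field_simps)
    have "61440 * (2 + x) \<le> y / 4" if "10 ^ 8 \<le> y" "10 ^ 16 * x \<le> y" "0 < x" for x y :: real
      using that by simp
    from this[OF 1 2 nm] have "61440 * (2 + n / m) \<le> m * \<epsilon>\<^sup>2 / 4" .
    also have "\<dots> \<le> m * K" using K mult_left_mono[OF K, of m] by simp
    finally have "61440 * (2 + n / m) \<le> m * K" .
    moreover have "16 * (2 + n / m) / m * K / (K / 8)\<^sup>2 = 1024 * (2 + n / m) / (m * K)"
      using K0 m by (simp add: power2_eq_square)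
    moreover have "0 < m * K" using K0 m by simp
    ultimately show ?thesis by (simp add: pos_divide_le_eq)
  qed
  finally have p1: "measure_pmf.prob R b1 \<le> 1 / 60" .
  have "measure_pmf.prob R b2 \<le> measure_pmf.expectation R VQ / (60 * (K + n / m))"
    unfolding b2_def VQ_def using K0 nm
    by (intro prob_ge_le_expectation finR) (auto intro!: integral_nonneg_AE add_pos_pos)
  also have "\<dots> \<le> (K + n / m) / (60 * (K + n / m))"
    using K0 nm null_second_moment_le unfolding VQ_def by (intro divide_right_mono) auto
  also have "\<dots> = 1 / 60" using add_pos_pos[OF K0 nm] by simp
  finally have p2: "measure_pmf.prob R b2 \<le> 1 / 60" .
  define B where "B = 5 * K + 2 * (n / m) * K + 3 * (n / m)"
  have B: "0 < B" unfolding B_def using K0 nm by (intro add_pos_pos mult_pos_pos) auto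
  have "measure_pmf.prob R b3 \<le> measure_pmf.expectation R VP / (60 * B)"
    unfolding b3_def VP_def B_def[symmetric] using B
    by (intro prob_ge_le_expectation finR) (auto intro!: integral_nonneg_AE)
  also have "\<dots> \<le> B / (60 * B)"
    using B alternative_second_moment_le unfolding VP_def B_def[symmetric] by (intro divide_right_mono) auto
  also have "\<dots> = 1 / 60" using B by simp
  finally have p3: "measure_pmf.prob R b3 \<le> 1 / 60" .
  have "measure_pmf.prob R (b1 \<union> b2 \<union> b3) \<le> 1 / 60 + 1 / 60 + 1 / 60"
    using measure_Un_le[of b1 "measure_pmf R" b2] measure_Un_le[of "b1 \<union> b2" "measure_pmf R" b3] p1 p2 p3
    by simp
  then have "1 - 1 / 20 \<le> measure_pmf.prob R (UNIV - (b1 \<union> b2 \<union> b3))"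
    using measure_pmf.prob_compl[of "b1 \<union> b2 \<union> b3" R] by simp
  also have "\<dots> \<le> measure_pmf.prob R {xs. K / 8 \<le> signal xs \<and>
    VQ xs \<le> 60 * (K + n / m) \<and> VP xs \<le> 60 * (5 * K + 2 * (n / m) * K + 3 * (n / m))}"
    using expectation_signal_ge
    by (intro measure_pmf.finite_measure_mono) (auto simp: b1_def b2_def b3_def abs_if split: if_splits)
  finally show ?thesis .
qed

text \<open>A good training separates the mean sums by at least \<open>X / 8\<close> with
  \<open>X = s * K\<close>. Half of this covers the threshold, and the other half is the deviation
  allowed in Chebyshev's inequality under \<open>P\<close>.\<close>

lemma detect_alternative:
  assumes \<epsilon>: "0 < \<epsilon>" "\<epsilon> \<le> 1" "\<epsilon> \<le> d_TV P Q"
    and sge: "10 ^ 8 / \<epsilon>\<^sup>2 \<le> s" and ms: "10 ^ 8 * real n / \<epsilon> ^ 4 \<le> real m * real s"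
    and good: "K / 8 \<le> signal xs"
      "measure_pmf.expectation Q (\<lambda>x. (f xs x)\<^sup>2) \<le> 60 * (K + n / m)"
      "measure_pmf.expectation P (\<lambda>x. (f xs x)\<^sup>2) \<le> 60 * (5 * K + 2 * (n / m) * K + 3 * (n / m))"
  shows "1 - 1 / 20 \<le> measure_pmf.prob (replicate_pmf s P) {ys. detect n m s \<epsilon> Q xs ys}"
proof -
  have K: "\<epsilon>\<^sup>2 / 4 \<le> K" using K_ge \<epsilon> by simp
  have K0: "0 < K" using K \<epsilon> by (smt (verit) zero_less_power divide_pos_pos)
  have e2: "0 < \<epsilon>\<^sup>2" "\<epsilon>\<^sup>2 \<le> 1" using \<epsilon> by (auto simp: power_le_one)
  have K4: "\<epsilon>\<^sup>2 \<le> 4 * K" "0 \<le> 4 * K" using K K0 by simp_all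
  have "0 < 10 ^ 8 / \<epsilon>\<^sup>2" using e2 by simp
  then have s: "0 < real s" using sge by linarith
  have nm0: "0 \<le> n / m" by simp
  define X where "X = s * K"
  have "10 ^ 8 \<le> s * \<epsilon>\<^sup>2" using sge e2 by (simp add: field_simps)
  also have "\<dots> \<le> s * (4 * K)" using K s by (intro mult_left_mono) auto
  finally have X: "25 * 10 ^ 6 \<le> X" by (simp add: X_def)
  have "10 ^ 8 * real n \<le> m * s * (\<epsilon>\<^sup>2 * \<epsilon>\<^sup>2)"
    using ms \<epsilon> by (simp add: field_simps power2_eq_square power4_eq_xxxx)
  then have nm: "10 ^ 8 * (n / m) \<le> s * (\<epsilon>\<^sup>2 * \<epsilon>\<^sup>2)" using m by (simp add: field_simps)
  also have "\<dots> \<le> s * ((4 * K) * (4 * K))"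
    using s e2 by (intro mult_left_mono mult_mono[OF K4(1,1) K4(2)]) simp_all
  finally have nm1: "n / m \<le> X * K / (625 * 10 ^ 4)" by (simp add: X_def)
  \<comment> \<open>Two bounds on \<open>n / m\<close> are kept. Estimating both factors
    \<open>\<epsilon>\<^sup>2\<close> by \<open>4 * K\<close> handles the terms in
    \<open>n / m\<close> alone; estimating one of them by 1 handles the term
    \<open>(n / m) * K\<close>.\<close>
  have "s * (\<epsilon>\<^sup>2 * \<epsilon>\<^sup>2) \<le> s * ((4 * K) * 1)"
    using s e2 by (intro mult_left_mono mult_mono[OF K4(1) _ K4(2)]) simp_all
  then have nm2: "n / m \<le> X / (25 * 10 ^ 6)" using nm by (simp add: X_def)
  have KX: "K \<le> X * K / (25 * 10 ^ 6)"
    using mult_right_mono[OF X, of K] K0 by simp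
  define g where "g = f xs"
  define VQ where "VQ = measure_pmf.expectation Q (\<lambda>x. (g x)\<^sup>2)"
  define VP where "VP = measure_pmf.expectation P (\<lambda>x. (g x)\<^sup>2)"
  have VQ: "VQ \<le> 60 * (K + n / m)" and VP: "VP \<le> 60 * (5 * K + 2 * (n / m) * K + 3 * (n / m))"
    using good by (auto simp: VQ_def VP_def g_def)
  define \<tau> where "\<tau> = sqrt (20 * (s * VQ)) + s * \<epsilon>\<^sup>2 / 128"
  have "\<tau> \<le> X / 16"
  proof -
    have "20 * (s * VQ) \<le> 20 * (s * (60 * (K + n / m)))"
      using VQ s by (intro mult_left_mono) auto
    also have "\<dots> \<le> 20 * (s * (60 * (X * K / (25 * 10 ^ 6) + X * K / (625 * 10 ^ 4))))"
      using nm1 KX s by (intro mult_left_mono add_mono) auto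
    also have "\<dots> = 24 / 10 ^ 5 * X\<^sup>2" by (simp add: X_def power2_eq_square)
    also have "\<dots> \<le> (X / 32)\<^sup>2" by (simp add: power_divide)
    finally have "sqrt (20 * (s * VQ)) \<le> X / 32"
      using X by (intro real_le_lsqrt) auto
    moreover have "s * \<epsilon>\<^sup>2 / 128 \<le> X / 32"
      using mult_left_mono[OF K, of s] s by (simp add: X_def)
    ultimately show ?thesis by (simp add: \<tau>_def)
  qed
  moreover have "s * (K / 8) \<le> s * signal xs" using good(1) s by (intro mult_left_mono) auto
  ultimately have gap: "s * measure_pmf.expectation Q g + \<tau> \<le> s * measure_pmf.expectation P g - X / 16"
    unfolding signal_eq g_def[symmetric] X_def by (simp add: algebra_simps)
  let ?bad = "{ys. X / 16 \<le> \<bar>sum_list (map g ys) - s * measure_pmf.expectation P g\<bar>}"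
  have "measure_pmf.prob (replicate_pmf s P) ?bad \<le> (s * VP) / (X / 16)\<^sup>2"
    using X variance_sum_list_le[OF finP, of s g]
    by (intro prob_deviation_le finite_set_replicate_pmf finP) (auto simp: VP_def)
  also have "\<dots> \<le> 1 / 20"
  proof -
    have "VP \<le> 60 * (5 * K + 2 * (n / m) * K + 3 * (n / m))" by (rule VP)
    also have "\<dots> \<le> 60 * (5 * (X * K / (25 * 10 ^ 6)) + 2 * (X / (25 * 10 ^ 6)) * K + 3 * (X * K / (625 * 10 ^ 4)))"
      using nm1 nm2 KX K0 by (intro mult_left_mono add_mono mult_right_mono) auto
    also have "\<dots> \<le> X * K / 5120" using X K0 by simp
    finally have "s * VP \<le> s * (X * K / 5120)" using s by (intro mult_left_mono) auto
    also have "\<dots> = X\<^sup>2 / 5120" by (simp add: X_def power2_eq_square)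
    finally show ?thesis using X by (simp add: power_divide pos_divide_le_eq)
  qed
  finally have "1 - 1 / 20 \<le> measure_pmf.prob (replicate_pmf s P) (UNIV - ?bad)"
    using measure_pmf.prob_compl[of ?bad "replicate_pmf s P"] by simp
  also have "\<dots> \<le> measure_pmf.prob (replicate_pmf s P) {ys. detect n m s \<epsilon> Q xs ys}"
    using gap X by (intro measure_pmf.finite_measure_mono)
      (auto simp: detect_def \<tau>_def VQ_def g_def abs_if split: if_splits)
  finally show ?thesis .
qed

end

text \<open>The probabilities are nested because one good training set must serve all later tests on
  \<open>P\<close>; a joint probability would not permit amplification with the training
  fixed.\<close>

lemma detection:
  assumes "1 \<le> n" "set_pmf P \<subseteq> {1..n}" "set_pmf Q \<subseteq> {1..n}"
    and "0 < \<epsilon>" "\<epsilon> \<le> 1" "\<epsilon> \<le> d_TV P Q"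
    and "10 ^ 8 * sqrt n / \<epsilon>\<^sup>2 \<le> m" "10 ^ 8 / \<epsilon>\<^sup>2 \<le> s" "10 ^ 8 * real n / \<epsilon> ^ 4 \<le> real m * real s"
  shows "1 - 1 / 20 \<le> measure_pmf.prob (replicate_pmf m P)
    {xs. 1 - 1 / 20 \<le> measure_pmf.prob (replicate_pmf s P) {ys. detect n m s \<epsilon> Q xs ys}}"
proof -
  have "0 < 10 ^ 8 * sqrt n / \<epsilon>\<^sup>2" using assms by simp
  then have "0 < real m" using assms(7) by linarith
  then interpret training n m P Q
    using assms by unfold_locales auto
  show ?thesis
    by (rule order_trans[OF good_training[OF assms(4-7)]], rule measure_pmf.finite_measure_mono)
      (auto intro!: detect_alternative[OF assms(4-6) assms(8-9), simplified] simp del: One_nat_def)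
qed

subsection \<open>The clustering algorithm\<close>

definition probe :: "nat \<Rightarrow> nat \<Rightarrow> nat \<Rightarrow> real \<Rightarrow> nat pmf \<Rightarrow> nat pmf \<Rightarrow> bool pmf" where
  "probe n m s \<epsilon> Q M
    = bind_pmf (replicate_pmf m M) (\<lambda>xs. map_pmf (detect n m s \<epsilon> Q xs) (replicate_pmf s M))"

definition candidate :: "nat \<Rightarrow> nat \<Rightarrow> (nat \<Rightarrow> bool pmf) \<Rightarrow> (nat \<times> bool) pmf" where
  "candidate k L t = bind_pmf (pmf_of_set {1..k}) (\<lambda>i. map_pmf (Pair i) (majority L (t i)))"

text \<open>An index of \<open>Q\<close> is recognised whatever the training set: in the search it
  is trained on samples of \<open>Q\<close>, in the classification on samples of the index
  found.\<close>

lemma probe_null: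
  assumes "set_pmf Q \<subseteq> {1..n}" "1 \<le> s" "0 < \<epsilon>"
  shows "9 / 10 \<le> measure_pmf.prob (map_pmf (detect n m s \<epsilon> Q xs) (replicate_pmf s Q)) {False}"
    and "9 / 10 \<le> measure_pmf.prob (probe n m s \<epsilon> Q Q) {False}"
proof -
  have 1: "1 - 1 / 20 \<le> measure_pmf.prob (map_pmf (detect n m s \<epsilon> Q xs) (replicate_pmf s Q)) {False}" for xs
  proof -
    let ?D = "{ys. detect n m s \<epsilon> Q xs ys}"
    have "measure_pmf.prob (replicate_pmf s Q) ?D \<le> 1 / 20"
      using assms finite_subset by (intro detect_null) auto
    then have "1 - 1 / 20 \<le> measure_pmf.prob (replicate_pmf s Q) (UNIV - ?D)"
      using measure_pmf.prob_compl[of ?D "replicate_pmf s Q"] by simp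
    also have "UNIV - ?D = detect n m s \<epsilon> Q xs -` {False}" by auto
    finally show ?thesis by simp
  qed
  show "9 / 10 \<le> measure_pmf.prob (map_pmf (detect n m s \<epsilon> Q xs) (replicate_pmf s Q)) {False}"
    using 1[of xs] by simp
  have "1 - (0 + 1 / 20) \<le> measure_pmf.prob (probe n m s \<epsilon> Q Q) {False}"
    unfolding probe_def by (rule prob_bind_ge[where A = UNIV]) (use 1 in auto)
  then show "9 / 10 \<le> measure_pmf.prob (probe n m s \<epsilon> Q Q) {False}" by simp
qed

lemma probe_alternative:
  assumes "1 - 1 / 20 \<le> measure_pmf.prob (replicate_pmf m P)
    {xs. 1 - 1 / 20 \<le> measure_pmf.prob (replicate_pmf s P) {ys. detect n m s \<epsilon> Q xs ys}}"
  shows "9 / 10 \<le> measure_pmf.prob (probe n m s \<epsilon> Q P) {True}"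
proof -
  have "1 - (1 / 20 + 1 / 20) \<le> measure_pmf.prob (probe n m s \<epsilon> Q P) {True}"
    unfolding probe_def by (rule prob_bind_ge[OF assms]) (simp_all add: vimage_def)
  then show ?thesis by simp
qed

lemma candidate_error:
  assumes "1 \<le> k" "I \<subseteq> {1..k}"
    and pos: "\<And>i. i \<in> I \<Longrightarrow> 9 / 10 \<le> measure_pmf.prob (t i) {True}"
    and neg: "\<And>i. i \<in> {1..k} - I \<Longrightarrow> 9 / 10 \<le> measure_pmf.prob (t i) {False}"
  shows "(1 - (3 / 5) ^ L) * card I / k \<le> measure_pmf.prob (candidate k L t) (I \<times> {True})"
    and "measure_pmf.prob (candidate k L t) ((- I) \<times> {True}) \<le> (3 / 5) ^ L"
proof -
  let ?\<beta> = "(3 / 5) ^ L :: real"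
  have ne: "{1..k} \<noteq> {}" using assms(1) by auto
  have eq: "measure_pmf.prob (candidate k L t) (J \<times> {True})
      = (\<Sum>i=1..k. if i \<in> J then measure_pmf.prob (majority L (t i)) {True} else 0) / k" for J
  proof -
    have "measure_pmf.prob (majority L (t i)) (Pair i -` (J \<times> {True}))
        = (if i \<in> J then measure_pmf.prob (majority L (t i)) {True} else 0)" for i
    proof (cases "i \<in> J")
      case True
      then have "Pair i -` (J \<times> {True}) = {True}" by auto
      then show ?thesis using True by simp
    next
      case False
      then have "Pair i -` (J \<times> {True}) = {}" by auto
      then show ?thesis using False by simp
    qed
    then show ?thesis
      unfolding candidate_def prob_bind_pmf integral_pmf_of_set[OF ne finite_atLeastAtMost] by simp
  qed
  have "(1 - ?\<beta>) * card I = (\<Sum>i\<in>I. 1 - ?\<beta>)" by simp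
  also have "\<dots> = (\<Sum>i=1..k. if i \<in> I then 1 - ?\<beta> else 0)"
    using assms(2) by (simp add: sum.inter_restrict[symmetric] Int_absorb1)
  also have "\<dots> \<le> (\<Sum>i=1..k. if i \<in> I then measure_pmf.prob (majority L (t i)) {True} else 0)"
    by (intro sum_mono) (auto intro: majority_error pos)
  finally show "(1 - ?\<beta>) * card I / k \<le> measure_pmf.prob (candidate k L t) (I \<times> {True})"
    unfolding eq by (intro divide_right_mono) auto
  have "(\<Sum>i=1..k. if i \<in> - I then measure_pmf.prob (majority L (t i)) {True} else 0) \<le> (\<Sum>i=1..k. ?\<beta>)"
  proof (rule sum_mono)
    fix i assume "i \<in> {1..k}"
    moreover have "measure_pmf.prob (majority L (t i)) {True} \<le> ?\<beta>" if "i \<in> {1..k} - I"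
    proof -
      have "1 - ?\<beta> \<le> measure_pmf.prob (majority L (t i)) {False}"
        by (intro majority_error neg that)
      moreover have "UNIV - {False} = {True}" by auto
      ultimately show ?thesis
        using measure_pmf.prob_compl[of "{False}" "majority L (t i)"] by simp
    qed
    ultimately show "(if i \<in> - I then measure_pmf.prob (majority L (t i)) {True} else 0) \<le> ?\<beta>"
      by simp
  qed
  then show "measure_pmf.prob (candidate k L t) ((- I) \<times> {True}) \<le> ?\<beta>"
    unfolding eq using assms(1) by (simp add: field_simps)
qed

text \<open>The votes differ between the stages: in the search each vote has its own training set,
  in the classification all votes on all indices share \<open>xs\<close>. The default index 1 is
  reached only by an unsuccessful search and may be wrong.\<close>

definition clustering ::
    "nat \<Rightarrow> nat \<Rightarrow> nat \<Rightarrow> nat \<Rightarrow> nat \<Rightarrow> nat \<Rightarrow> nat \<Rightarrow> real \<Rightarrow> nat pmf \<Rightarrow> (nat \<Rightarrow> nat pmf) \<Rightarrow> nat set pmf" where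
  "clustering n k T L m\<^sub>1 m\<^sub>2 s\<^sub>2 \<epsilon> Q D =
    bind_pmf (first_flagged (candidate k L (\<lambda>i. probe n m\<^sub>1 m\<^sub>1 \<epsilon> Q (D i))) 1 T) (\<lambda>i.
    bind_pmf (replicate_pmf m\<^sub>2 (D i)) (\<lambda>xs.
    classify (\<lambda>j. majority L (map_pmf (detect n m\<^sub>2 s\<^sub>2 \<epsilon> Q xs) (replicate_pmf s\<^sub>2 (D j)))) [1..<Suc k]))"

lemma realizable_clustering:
  "realizable (T * (1 + L * (m\<^sub>1 + m\<^sub>1)) + (m\<^sub>2 + k * (L * s\<^sub>2))) (clustering n k T L m\<^sub>1 m\<^sub>2 s\<^sub>2 \<epsilon> Q)"
proof -
  have "realizable (1 + L * (m\<^sub>1 + m\<^sub>1)) (\<lambda>D. candidate k L (\<lambda>i. probe n m\<^sub>1 m\<^sub>1 \<epsilon> Q (D i)))"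
    unfolding candidate_def probe_def One_nat_def
    by (intro realizable_bind realizable_random realizable_map realizable_majority realizable_samples)
  moreover have "realizable (length [1..<Suc k] * (L * s\<^sub>2)) (\<lambda>D.
      classify (\<lambda>j. majority L (map_pmf (detect n m\<^sub>2 s\<^sub>2 \<epsilon> Q xs) (replicate_pmf s\<^sub>2 (D j)))) [1..<Suc k])" for xs
    by (intro realizable_classify realizable_majority realizable_map realizable_samples)
  ultimately have "realizable (T * (1 + L * (m\<^sub>1 + m\<^sub>1)) + (m\<^sub>2 + length [1..<Suc k] * (L * s\<^sub>2)))
      (clustering n k T L m\<^sub>1 m\<^sub>2 s\<^sub>2 \<epsilon> Q)"
    unfolding clustering_def[abs_def]
    by (intro realizable_bind realizable_first_flagged realizable_samples)
  then show ?thesis by (simp only: length_upt diff_Suc_1)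
qed

lemma clustering_correct:
  assumes n: "1 \<le> n" and k: "2 \<le> k" and \<epsilon>: "0 < \<epsilon>" "\<epsilon> \<le> 1"
    and Q: "set_pmf Q \<subseteq> {1..n}" and P: "set_pmf P \<subseteq> {1..n}"
    and I: "I \<subseteq> {1..k}" "I \<noteq> {}"
    and D: "\<forall>i\<in>I. D i = P" "\<forall>i\<in>{1..k} - I. D i = Q" and TV: "\<epsilon> \<le> d_TV P Q"
    and T: "8 * real k / real (card I) \<le> real T" and L: "(3 / 5) ^ L \<le> 1 / (512 * real k)"
    and m1: "10 ^ 8 * sqrt n / \<epsilon>\<^sup>2 \<le> m\<^sub>1"
    and m2: "10 ^ 8 * sqrt n / \<epsilon>\<^sup>2 \<le> m\<^sub>2"
    and s2: "10 ^ 8 / \<epsilon>\<^sup>2 \<le> s\<^sub>2" "10 ^ 8 * real n / \<epsilon> ^ 4 \<le> real m\<^sub>2 * real s\<^sub>2"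
  shows "2 / 3 \<le> measure_pmf.prob (clustering n k T L m\<^sub>1 m\<^sub>2 s\<^sub>2 \<epsilon> Q D) {I}"
proof -
  define \<beta> :: real where "\<beta> = (3 / 5) ^ L"
  define r where "r = card I"
  have r: "1 \<le> r" "r \<le> k"
    using I card_mono[OF _ I(1)] finite_subset[OF I(1)] by (auto simp: r_def Suc_le_eq card_gt_0_iff)
  have kb: "real k * \<beta> \<le> 1 / 512"
    using L k by (simp add: \<beta>_def field_simps)
  have \<beta>: "0 \<le> \<beta>" "\<beta> \<le> 1 / 512"
  proof -
    show "0 \<le> \<beta>" by (simp add: \<beta>_def)
    then have "1 * \<beta> \<le> real k * \<beta>" using k by (intro mult_right_mono) auto
    then show "\<beta> \<le> 1 / 512" using kb by simp
  qed
  have e2: "0 < \<epsilon>\<^sup>2" "\<epsilon>\<^sup>2 \<le> 1" using \<epsilon> by (auto simp: power_le_one)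
  have ge1: "1 \<le> 10 ^ 8 / \<epsilon>\<^sup>2" using e2 by (simp add: field_simps)
  have sq: "10 ^ 8 / \<epsilon>\<^sup>2 \<le> 10 ^ 8 * sqrt n / \<epsilon>\<^sup>2"
    using n by (intro divide_right_mono) auto
  have m11: "10 ^ 8 / \<epsilon>\<^sup>2 \<le> m\<^sub>1" "1 \<le> m\<^sub>1"
    using ge1 sq m1 by linarith+
  have s21: "1 \<le> s\<^sub>2" using ge1 s2(1) by linarith
  have "10 ^ 8 * real n / \<epsilon> ^ 4 \<le> real m\<^sub>1 * real m\<^sub>1"
  proof -
    have "10 ^ 8 * real n / \<epsilon> ^ 4 \<le> 10 ^ 16 * real n / \<epsilon> ^ 4"
      by (intro divide_right_mono) auto
    also have "\<dots> = 10 ^ 16 * (sqrt n * sqrt n) / \<epsilon> ^ 4"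
      by (simp only: real_sqrt_mult_self abs_of_nat)
    also have "\<dots> = (10 ^ 8 * sqrt n / \<epsilon>\<^sup>2) * (10 ^ 8 * sqrt n / \<epsilon>\<^sup>2)"
      by (simp add: power2_eq_square power4_eq_xxxx del: real_sqrt_mult_self)
    also have "\<dots> \<le> real m\<^sub>1 * real m\<^sub>1"
      by (rule mult_mono[OF m1 m1]) auto
    finally show ?thesis .
  qed
  then have det1: "1 - 1 / 20 \<le> measure_pmf.prob (replicate_pmf m\<^sub>1 P)
    {xs. 1 - 1 / 20 \<le> measure_pmf.prob (replicate_pmf m\<^sub>1 P) {ys. detect n m\<^sub>1 m\<^sub>1 \<epsilon> Q xs ys}}"
    by (intro detection n P Q \<epsilon> TV m1 m11)
  let ?t = "\<lambda>i. probe n m\<^sub>1 m\<^sub>1 \<epsilon> Q (D i)"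
  have pos: "9 / 10 \<le> measure_pmf.prob (?t i) {True}" if "i \<in> I" for i
    using probe_alternative[OF det1] D that by simp
  have neg: "9 / 10 \<le> measure_pmf.prob (?t i) {False}" if "i \<in> {1..k} - I" for i
    using probe_null(2)[OF Q m11(2) \<epsilon>(1)] D that by simp
  \<comment> \<open>A round picks an index of \<open>P\<close> with probability
    \<open>r / k\<close>, and its majority vote is right with probability at least 1/2.\<close>
  define g where "g = r / (2 * real k)"
  have g0: "0 < g" "g \<le> 1" using r k by (auto simp: g_def field_simps)
  have "g \<le> (1 - \<beta>) * r / k"
  proof -
    have "1 / 2 * (real r / k) \<le> (1 - \<beta>) * (real r / k)"
      using \<beta> by (intro mult_right_mono) auto
    then show ?thesis by (simp add: g_def)
  qed
  also have "\<dots> \<le> measure_pmf.prob (candidate k L ?t) (I \<times> {True})"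
    unfolding \<beta>_def r_def using k by (intro candidate_error pos neg I) auto
  finally have g: "g \<le> measure_pmf.prob (candidate k L ?t) (I \<times> {True})" .
  have e: "measure_pmf.prob (candidate k L ?t) ((- I) \<times> {True}) \<le> \<beta>"
    unfolding \<beta>_def using k by (intro candidate_error pos neg I) auto
  let ?find = "first_flagged (candidate k L ?t) 1 T"
  have "measure_pmf.prob ?find (- I) \<le> \<beta> / g + (1 - g) ^ T"
    by (rule first_flagged_error[OF g g0(1) e])
  also have "\<dots> \<le> 1 / 256 + 1 / 5"
  \<comment> \<open>False flags cost \<open>\<beta> / g\<close>, at most 2/512; missing all indices
    of \<open>P\<close> costs at most exp (-4), because \<open>T * g\<close> is at least 4.\<close>
  proof (rule add_mono)
    have "\<beta> / g = 2 * (k * \<beta>) / r" by (simp add: g_def)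
    also have "\<dots> \<le> 2 * (k * \<beta>) / 1" using r \<beta> by (intro divide_left_mono) auto
    finally show "\<beta> / g \<le> 1 / 256" using kb by linarith
    have "(1 - g) ^ T \<le> exp (- g) ^ T"
      using g0 exp_ge_add_one_self[of "- g"] by (intro power_mono) auto
    also have "\<dots> = exp (- (T * g))" by (simp add: exp_of_nat_mult[symmetric])
    also have "\<dots> \<le> exp (- 4)"
    proof -
      have "8 * k / r * g \<le> T * g" using T g0 by (intro mult_right_mono) (auto simp: r_def)
      moreover have "8 * k / r * g = 4" using r k by (simp add: g_def)
      ultimately show ?thesis by simp
    qed
    also have "\<dots> \<le> 1 / 5"
      using exp_ge_add_one_self[of "4::real"] by (simp add: exp_minus field_simps)
    finally show "(1 - g) ^ T \<le> 1 / 5" .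
  qed
  finally have "1 - 53 / 256 \<le> measure_pmf.prob ?find (UNIV - (- I))"
    using measure_pmf.prob_compl[of "- I" ?find] by simp
  then have find: "1 - 53 / 256 \<le> measure_pmf.prob ?find I"
    by (simp add: Compl_eq_Diff_UNIV[symmetric])
  have det2: "1 - 1 / 20 \<le> measure_pmf.prob (replicate_pmf m\<^sub>2 P)
    {xs. 1 - 1 / 20 \<le> measure_pmf.prob (replicate_pmf s\<^sub>2 P) {ys. detect n m\<^sub>2 s\<^sub>2 \<epsilon> Q xs ys}}"
    by (intro detection n P Q \<epsilon> TV m2 s2)
  have cls: "1 - 1 / 512 \<le> measure_pmf.prob
      (classify (\<lambda>j. majority L (map_pmf (detect n m\<^sub>2 s\<^sub>2 \<epsilon> Q xs) (replicate_pmf s\<^sub>2 (D j)))) [1..<Suc k]) {I}"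
    if xs: "1 - 1 / 20 \<le> measure_pmf.prob (replicate_pmf s\<^sub>2 P) {ys. detect n m\<^sub>2 s\<^sub>2 \<epsilon> Q xs ys}" for xs
  proof -
    let ?u = "\<lambda>j. majority L (map_pmf (detect n m\<^sub>2 s\<^sub>2 \<epsilon> Q xs) (replicate_pmf s\<^sub>2 (D j)))"
    have "1 - \<beta> \<le> measure_pmf.prob (?u j) {j \<in> I}" if "j \<in> set [1..<Suc k]" for j
    proof (cases "j \<in> I")
      case True
      have "9 / 10 \<le> measure_pmf.prob (map_pmf (detect n m\<^sub>2 s\<^sub>2 \<epsilon> Q xs) (replicate_pmf s\<^sub>2 (D j))) {True}"
        using xs D True by (simp add: vimage_def)
      then show ?thesis unfolding \<beta>_def using True by (simp add: majority_error)
    next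
      case False
      then have "D j = Q" using D that by auto
      then have "9 / 10 \<le> measure_pmf.prob (map_pmf (detect n m\<^sub>2 s\<^sub>2 \<epsilon> Q xs) (replicate_pmf s\<^sub>2 (D j))) {False}"
        using probe_null(1)[OF Q s21 \<epsilon>(1)] by simp
      then show ?thesis unfolding \<beta>_def using False by (simp add: majority_error)
    qed
    then have "1 - length [1..<Suc k] * \<beta> \<le> measure_pmf.prob (classify ?u [1..<Suc k]) {I \<inter> set [1..<Suc k]}"
      using \<beta> kb by (intro classify_error) auto
    moreover have "I \<inter> set [1..<Suc k] = I" using I(1) by auto
    ultimately have "1 - k * \<beta> \<le> measure_pmf.prob (classify ?u [1..<Suc k]) {I}"
      by (simp only: length_upt diff_Suc_1)
    then show ?thesis using kb by linarith
  qed
  \<comment> \<open>The errors are 53/256 for the search, 1/20 for the training and 1/512 for the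
    classification; their sum is below 1/3.\<close>
  have "1 - (53 / 256 + (1 / 20 + 1 / 512)) \<le> measure_pmf.prob (clustering n k T L m\<^sub>1 m\<^sub>2 s\<^sub>2 \<epsilon> Q D) {I}"
    unfolding clustering_def
  proof (rule prob_bind_ge[OF find])
    fix i assume "i \<in> I"
    then have "D i = P" using D by simp
    show "1 - (1 / 20 + 1 / 512) \<le> measure_pmf.prob (bind_pmf (replicate_pmf m\<^sub>2 (D i)) (\<lambda>xs.
        classify (\<lambda>j. majority L (map_pmf (detect n m\<^sub>2 s\<^sub>2 \<epsilon> Q xs) (replicate_pmf s\<^sub>2 (D j)))) [1..<Suc k])) {I}"
      unfolding \<open>D i = P\<close> by (rule prob_bind_ge[OF det2 _ _ _ cls]) auto
  qed auto
  then show ?thesis by simp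
qed

subsection \<open>The sample budget\<close>

text \<open>Rounding up adds at most 1, which is absorbed into the constant because \<open>y\<close>
  is at least 1.\<close>

lemma nat_between:
  fixes c y :: real
  assumes "0 \<le> c" "1 \<le> y"
  obtains m :: nat where "c * y \<le> m" "m \<le> (c + 1) * y"
proof
  have "0 \<le> c * y" using assms by simp
  then have "real (nat \<lceil>c * y\<rceil>) = of_int \<lceil>c * y\<rceil>" by simp
  then show "c * y \<le> real (nat \<lceil>c * y\<rceil>)" "real (nat \<lceil>c * y\<rceil>) \<le> (c + 1) * y"
    using assms of_int_ceiling_le_add_one[of "c * y"] le_of_int_ceiling[of "c * y"]
    by (simp_all only: distrib_right)
qed

lemma ln_ge_half: "2 \<le> k \<Longrightarrow> 1 / 2 \<le> ln (real k)"
proof -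
  assume k: "2 \<le> k"
  have "(1::real) / 2 \<le> ln 2" using ln2_ge_two_thirds by simp
  also have "\<dots> \<le> ln (real k)" using k by simp
  finally show ?thesis .
qed

lemma parameters:
  assumes n: "1 \<le> n" and k: "2 \<le> k" and \<epsilon>: "0 < \<epsilon>" "\<epsilon> \<le> 1" and r: "1 \<le> r" "r \<le> k"
  obtains T L m\<^sub>1 m\<^sub>2 s\<^sub>2 :: nat where
    "8 * real k / real r \<le> real T" "(3 / 5) ^ L \<le> 1 / (512 * real k)"
    "10 ^ 8 * sqrt n / \<epsilon>\<^sup>2 \<le> m\<^sub>1" "10 ^ 8 * sqrt n / \<epsilon>\<^sup>2 \<le> m\<^sub>2"
    "10 ^ 8 / \<epsilon>\<^sup>2 \<le> s\<^sub>2" "10 ^ 8 * real n / \<epsilon> ^ 4 \<le> real m\<^sub>2 * real s\<^sub>2"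
    "T * (1 + L * (m\<^sub>1 + m\<^sub>1)) + (m\<^sub>2 + k * (L * s\<^sub>2)) \<le> nat \<lfloor>budget (10 ^ 11) n k \<epsilon> r\<rfloor>"
proof -
  define l where "l = ln (real k)"
  have l: "1 / 2 \<le> l" using ln_ge_half[OF k] by (simp add: l_def)
  define e where "e = 1 / \<epsilon>\<^sup>2"
  have e: "1 \<le> e" using \<epsilon> by (simp add: e_def field_simps power_le_one)
  have sn: "1 \<le> sqrt n" using n by simp
  have sne: "1 \<le> sqrt n * e" using mult_mono[OF sn e] by simp
  have ee: "1 / \<epsilon> ^ 4 = e * e" by (simp add: e_def power2_eq_square power4_eq_xxxx)
  define H where "H = k * l"
  have H: "1 \<le> H" using mult_mono[of 2 "real k" "1 / 2" l] k l by (simp add: H_def)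
  obtain T :: nat where T: "8 * (k / r) \<le> T" "T \<le> (8 + 1) * (k / r)"
    using nat_between[of 8 "k / r"] r by auto
  \<comment> \<open>About 25 ln k votes: (3/5)^L <= exp (-2 L / 5) is then at most k^(-10), and k^9
    >= 2^9 = 512. The factor 2 makes \<open>2 * l\<close> at least 1, as rounding requires.\<close>
  obtain L :: nat where L: "25 / 2 * (2 * l) \<le> L" "L \<le> (25 / 2 + 1) * (2 * l)"
    using nat_between[of "25 / 2" "2 * l"] l by auto
  obtain m1 :: nat where m1: "10 ^ 8 * (sqrt n * e) \<le> m1" "m1 \<le> (10 ^ 8 + 1) * (sqrt n * e)"
    using nat_between[of "10 ^ 8" "sqrt n * e"] sne by auto
  have Lk: "(3 / 5) ^ L \<le> 1 / (512 * real k)"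
  proof -
    have "(3 / 5 :: real) ^ L \<le> exp (- 2 / 5) ^ L"
      using exp_ge_add_one_self[of "- 2 / 5 :: real"] by (intro power_mono) auto
    also have "\<dots> = exp (- (L * 2 / 5))" by (simp add: exp_of_nat_mult[symmetric])
    also have "\<dots> \<le> exp (- (10 * l))" using L by simp
    also have "\<dots> = 1 / real k ^ 10"
    proof -
      have "exp (10 * l) = exp l ^ 10" by (simp flip: exp_of_nat_mult)
      also have "exp l = k" using k by (simp add: l_def)
      finally show ?thesis by (simp add: exp_minus field_simps)
    qed
    also have "\<dots> \<le> 1 / (512 * real k)"
    proof -
      have "(2::real) ^ 9 * k \<le> real k ^ 9 * k" using k by (intro mult_right_mono power_mono) auto
      also have "\<dots> = real k ^ 10" by (simp add: eval_nat_numeral)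
      finally show ?thesis using k by (intro divide_left_mono) auto
    qed
    finally show ?thesis .
  qed
  define Y where "Y = sqrt n * e * l * (k / r)"
  have stage1: "T * (1 + L * (real m1 + m1)) \<le> 5 * 10 ^ 10 * Y"
  proof -
    have "1 \<le> 2 * (sqrt n * e * l)" using mult_mono[OF sne, of "1 / 2" l] l sne by simp
    moreover have "L * real m1 \<le> (25 / 2 + 1) * (2 * l) * ((10 ^ 8 + 1) * (sqrt n * e))"
      using L m1 l by (intro mult_mono) auto
    ultimately have "1 + L * (real m1 + m1) \<le> 55 * 10 ^ 8 * (sqrt n * e * l)"
      by (simp add: algebra_simps)
    then have "T * (1 + L * (real m1 + m1)) \<le> ((8 + 1) * (k / r)) * (55 * 10 ^ 8 * (sqrt n * e * l))"
      using T by (intro mult_mono) auto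
    also have "\<dots> = 495 * 10 ^ 8 * Y" by (simp add: Y_def)
    also have "\<dots> \<le> 5 * 10 ^ 10 * Y"
      using sne l by (intro mult_right_mono) (auto simp: Y_def)
    finally show ?thesis .
  qed
  have Y0: "0 \<le> Y" using sne l by (simp add: Y_def)
  \<comment> \<open>\<open>Y\<close> and \<open>Z\<close> are the two summands of the budget without
    the constant: \<open>Y\<close> pays for the search, \<open>Z\<close> for the single training and
    the final classification.\<close>
  define Z where "Z = (if n \<ge> H then sqrt (n * H) * e else H * e)"
  have budget: "budget (10 ^ 11) n k \<epsilon> r = 10 ^ 11 * (Y + Z)"
    by (simp add: budget_def Y_def Z_def H_def e_def l_def mult_ac)
  obtain m2 s2 :: nat where ms: "10 ^ 8 * sqrt n * e \<le> m2" "10 ^ 8 * e \<le> s2"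
    "10 ^ 8 * real n * (e * e) \<le> real m2 * real s2"
    "m2 \<le> (10 ^ 8 + 1) * Z" "H * s2 \<le> (10 ^ 8 + 1) * Z"
  proof (cases "n \<ge> H")
    \<comment> \<open>Training costs \<open>m2\<close> and classification about
      \<open>H * s2\<close>. Under the constraint on \<open>m2 * s2\<close> the sum is balanced by
      \<open>m2 = H * s2\<close>, that is sqrt (n H) against sqrt (n / H).\<close>
    case True
    have n0: "0 < real n" using n by simp
    have H0: "0 < H" using H by simp
    have nH: "sqrt n \<le> sqrt (n * H)" using H n0 by simp
    have nH': "1 \<le> sqrt (n / H)" using True H0 by simp
    have y: "1 \<le> sqrt (n * H) * e" "1 \<le> sqrt (n / H) * e"
      using mult_mono[OF _ e, of 1 "sqrt (n * H)"] mult_mono[OF nH' e] nH sn by auto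
    obtain m2 :: nat where m2: "10 ^ 8 * (sqrt (n * H) * e) \<le> m2" "m2 \<le> (10 ^ 8 + 1) * (sqrt (n * H) * e)"
      using nat_between[of "10 ^ 8" "sqrt (n * H) * e"] y by auto
    obtain s2 :: nat where s2: "10 ^ 8 * (sqrt (n / H) * e) \<le> s2" "s2 \<le> (10 ^ 8 + 1) * (sqrt (n / H) * e)"
      using nat_between[of "10 ^ 8" "sqrt (n / H) * e"] y by auto
    have HH: "H * sqrt (n / H) = sqrt (n * H)"
    proof -
      have "H = sqrt (H * H)" using H0 by simp
      then have "H * sqrt (n / H) = sqrt (H * H * (n / H))" by (metis real_sqrt_mult)
      also have "H * H * (n / H) = n * H" using H0 by simp
      finally show ?thesis .
    qed
    show ?thesis
    proof
      have "sqrt n * e \<le> sqrt (n * H) * e" using nH e by (intro mult_right_mono) auto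
      then show "10 ^ 8 * sqrt n * e \<le> m2" using m2(1) by simp
      have "1 * e \<le> sqrt (n / H) * e" using nH' e by (intro mult_right_mono) auto
      then show "10 ^ 8 * e \<le> s2" using s2(1) by simp
      have "sqrt (n * H) * sqrt (n / H) = n" using H0 n0 by (simp add: real_sqrt_mult[symmetric])
      then have "10 ^ 16 * real n * (e * e) = (10 ^ 8 * (sqrt (n * H) * e)) * (10 ^ 8 * (sqrt (n / H) * e))"
        by (simp add: mult_ac)
      also have "\<dots> \<le> real m2 * real s2"
        using m2 s2 y by (intro mult_mono) auto
      finally have "10 ^ 16 * (real n * (e * e)) \<le> real m2 * real s2"
        by (simp only: mult.assoc)
      moreover have "10 ^ 8 * (real n * (e * e)) \<le> 10 ^ 16 * (real n * (e * e))"
        by (intro mult_right_mono) auto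
      ultimately show "10 ^ 8 * real n * (e * e) \<le> real m2 * real s2"
        unfolding mult.assoc by linarith
      show "m2 \<le> (10 ^ 8 + 1) * Z" using m2 True by (simp add: Z_def)
      have "H * s2 \<le> H * ((10 ^ 8 + 1) * (sqrt (n / H) * e))" using s2 H0 by (intro mult_left_mono) auto
      also have "\<dots> = (10 ^ 8 + 1) * ((H * sqrt (n / H)) * e)" by simp
      finally show "H * s2 \<le> (10 ^ 8 + 1) * Z" using True by (simp add: Z_def HH)
    qed
  next
    \<comment> \<open>Here sqrt (n / H) is below 1, so balancing would violate the lower bound on
      \<open>s2\<close>. Instead \<open>s2\<close> stays at the order of that bound and
      \<open>m2\<close> is of order \<open>n * e\<close>, which is at most
      \<open>H * e\<close>.\<close>
    case False
    have n1: "1 \<le> real n" using n by simp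
    have y: "1 \<le> n * e" using mult_mono[OF n1 e] by simp
    obtain m2 :: nat where m2: "10 ^ 8 * (n * e) \<le> m2" "m2 \<le> (10 ^ 8 + 1) * (n * e)"
      using nat_between[of "10 ^ 8" "n * e"] y by auto
    obtain s2 :: nat where s2: "10 ^ 8 * e \<le> s2" "s2 \<le> (10 ^ 8 + 1) * e"
      using nat_between[of "10 ^ 8" e] e by auto
    show ?thesis
    proof
      have "sqrt n \<le> n" using n1 by (intro real_le_lsqrt) (auto simp: power2_eq_square)
      then have "sqrt n * e \<le> n * e" using e by (intro mult_right_mono) auto
      then show "10 ^ 8 * sqrt n * e \<le> m2" using m2(1) by simp
      show "10 ^ 8 * e \<le> s2" by (rule s2)
      have "(10 ^ 8 * (n * e)) * (10 ^ 8 * e) \<le> real m2 * real s2"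
        using m2 s2 e by (intro mult_mono) auto
      moreover have "10 ^ 8 * (real n * (e * e)) \<le> 10 ^ 16 * (real n * (e * e))"
        by (intro mult_right_mono) auto
      ultimately show "10 ^ 8 * real n * (e * e) \<le> real m2 * real s2" by (simp add: mult_ac)
      have "n * e \<le> H * e" using False e by (intro mult_right_mono) auto
      then show "m2 \<le> (10 ^ 8 + 1) * Z" using m2(2) False by (simp add: Z_def)
      have "H * s2 \<le> H * ((10 ^ 8 + 1) * e)" using s2 H by (intro mult_left_mono) auto
      then show "H * s2 \<le> (10 ^ 8 + 1) * Z" using False by (simp add: Z_def)
    qed
  qed
  have Z0: "0 \<le> Z" using ms(4) by (smt (verit) of_nat_0_le_iff zero_le_mult_iff zero_less_power)
  show ?thesis
  proof
    show "8 * real k / real r \<le> real T" using T by simp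
    show "(3 / 5) ^ L \<le> 1 / (512 * real k)" by (rule Lk)
    show "10 ^ 8 * sqrt n / \<epsilon>\<^sup>2 \<le> m1" using m1 by (simp add: e_def)
    show "10 ^ 8 * sqrt n / \<epsilon>\<^sup>2 \<le> m2" using ms by (simp add: e_def)
    show "10 ^ 8 / \<epsilon>\<^sup>2 \<le> s2" using ms by (simp add: e_def)
    show "10 ^ 8 * real n / \<epsilon> ^ 4 \<le> real m2 * real s2"
      using ms(3) unfolding ee[symmetric] by simp
    have "k * (L * real s2) \<le> k * (((25 / 2 + 1) * (2 * l)) * real s2)"
      using L by (intro mult_left_mono mult_right_mono) auto
    also have "\<dots> = 27 * (H * s2)" by (simp add: H_def)
    finally have stage3: "k * (L * real s2) \<le> 27 * ((10 ^ 8 + 1) * Z)" using ms(5) by simp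
    have "a + (b + c) \<le> 10 ^ 11 * (Y + Z)"
      if "a \<le> 5 * 10 ^ 10 * Y" "b \<le> (10 ^ 8 + 1) * Z" "c \<le> 27 * ((10 ^ 8 + 1) * Z)" for a b c
      using that Y0 Z0 by simp
    from this[OF stage1 ms(4) stage3]
    have "real (T * (1 + L * (m1 + m1)) + (m2 + k * (L * s2))) \<le> 10 ^ 11 * (Y + Z)"
      by (simp only: of_nat_add of_nat_mult of_nat_1)
    also have "\<dots> = budget (10 ^ 11) n k \<epsilon> r" by (rule budget[symmetric])
    finally show "T * (1 + L * (m1 + m1)) + (m2 + k * (L * s2)) \<le> nat \<lfloor>budget (10 ^ 11) n k \<epsilon> r\<rfloor>"
      by (rule le_nat_floor)
  qed
qed

section \<open>Choice of the algorithm and the final bound\<close>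

theorem theoremC1:
  "\<exists>C::real. C > 0 \<and>
     (\<exists>Alg :: nat \<Rightarrow> nat \<Rightarrow> real \<Rightarrow> nat pmf \<Rightarrow> nat \<Rightarrow> algorithm.
       \<forall>n k \<epsilon> Q r P D I.
         n \<ge> 1 \<and> k \<ge> 2 \<and> 0 < \<epsilon> \<and> \<epsilon> \<le> 1 \<and>
         set_pmf Q \<subseteq> {1..n} \<and> set_pmf P \<subseteq> {1..n} \<and>
         I \<subseteq> {1..k} \<and> I \<noteq> {} \<and> I \<noteq> {1..k} \<and> card I = r \<and>
         (\<forall>i\<in>I. D i = P) \<and> (\<forall>i\<in>{1..k} - I. D i = Q) \<and>
         d_TV P Q \<ge> \<epsilon>
         \<longrightarrow> measure_pmf.prob (run (Alg n k \<epsilon> Q r) D (nat \<lfloor>budget C n k \<epsilon> r\<rfloor>) [])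
               {Some I, Some ({1..k} - I)} \<ge> 2/3)"
proof -
  \<comment> \<open>The algorithm may depend only on \<open>n\<close>, \<open>k\<close>,
    \<open>\<epsilon>\<close>, \<open>Q\<close> and \<open>r\<close>. With \<open>P\<close>,
    \<open>D\<close> and \<open>I\<close> quantified inside \<open>ok\<close>, choosing a witness
    for each parameter tuple yields \<open>Alg\<close>.\<close>
  define ok where "ok n k \<epsilon> Q r A \<longleftrightarrow> (\<forall>P D I. 1 \<le> n \<and> 2 \<le> k \<and> 0 < \<epsilon> \<and> \<epsilon> \<le> 1 \<and>
      set_pmf Q \<subseteq> {1..n} \<and> set_pmf P \<subseteq> {1..n} \<and>
      I \<subseteq> {1..k} \<and> I \<noteq> {} \<and> I \<noteq> {1..k} \<and> card I = r \<and>
      (\<forall>i\<in>I. D i = P) \<and> (\<forall>i\<in>{1..k} - I. D i = Q) \<and> \<epsilon> \<le> d_TV P Q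
      \<longrightarrow> 2 / 3 \<le> measure_pmf.prob (run A D (nat \<lfloor>budget (10 ^ 11) n k \<epsilon> r\<rfloor>) [])
            {Some I, Some ({1..k} - I)})" for n k r :: nat and \<epsilon> :: real and Q :: "nat pmf" and A
  have "\<exists>A. ok n k \<epsilon> Q r A" for n k \<epsilon> Q r
  proof (cases "1 \<le> n \<and> 2 \<le> k \<and> 0 < \<epsilon> \<and> \<epsilon> \<le> 1 \<and> 1 \<le> r \<and> r \<le> k")
    case True
    obtain T L m1 m2 s2 :: nat where par:
      "8 * real k / real r \<le> real T" "(3 / 5) ^ L \<le> 1 / (512 * real k)"
      "10 ^ 8 * sqrt n / \<epsilon>\<^sup>2 \<le> m1" "10 ^ 8 * sqrt n / \<epsilon>\<^sup>2 \<le> m2"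
      "10 ^ 8 / \<epsilon>\<^sup>2 \<le> s2" "10 ^ 8 * real n / \<epsilon> ^ 4 \<le> real m2 * real s2"
      "T * (1 + L * (m1 + m1)) + (m2 + k * (L * s2)) \<le> nat \<lfloor>budget (10 ^ 11) n k \<epsilon> r\<rfloor>"
      by (rule parameters[of n k \<epsilon> r]) (use True in auto)
    obtain A where A: "\<And>D b. T * (1 + L * (m1 + m1)) + (m2 + k * (L * s2)) \<le> b
        \<Longrightarrow> run A D b [] = map_pmf Some (clustering n k T L m1 m2 s2 \<epsilon> Q D)"
      using realizable_run[OF realizable_clustering] by blast
    have "2 / 3 \<le> measure_pmf.prob (run A D (nat \<lfloor>budget (10 ^ 11) n k \<epsilon> r\<rfloor>) [])
        {Some I, Some ({1..k} - I)}"
      if h: "set_pmf Q \<subseteq> {1..n}" "set_pmf P \<subseteq> {1..n}" "I \<subseteq> {1..k}" "I \<noteq> {}" "card I = r"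
        "\<forall>i\<in>I. D i = P" "\<forall>i\<in>{1..k} - I. D i = Q" "\<epsilon> \<le> d_TV P Q" for P D I
    proof -
      have "2 / 3 \<le> measure_pmf.prob (clustering n k T L m1 m2 s2 \<epsilon> Q D) {I}"
        by (rule clustering_correct[of n k \<epsilon> Q P I D]) (use True h par in simp_all)
      also have "\<dots> \<le> measure_pmf.prob (clustering n k T L m1 m2 s2 \<epsilon> Q D)
          (Some -` {Some I, Some ({1..k} - I)})"
        by (intro measure_pmf.finite_measure_mono) auto
      finally show ?thesis by (simp only: A[OF par(7)] measure_map_pmf)
    qed
    then have "ok n k \<epsilon> Q r A" unfolding ok_def by blast
    then show ?thesis by blast
  next
    \<comment> \<open>Outside the admissible parameters the assumptions are contradictory, since a
      nonempty subset of \<open>{1..k}\<close> has between 1 and \<open>k\<close> elements; any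
      algorithm will do.\<close>
    case False
    have "1 \<le> card I \<and> card I \<le> k" if "I \<subseteq> {1..k}" "I \<noteq> {}" for I
      using that card_mono[OF _ that(1)] finite_subset[OF that(1)]
      by (auto simp: Suc_le_eq card_gt_0_iff)
    with False have "ok n k \<epsilon> Q r A" for A unfolding ok_def by blast
    then show ?thesis by blast
  qed
  then obtain Alg where "\<And>n k \<epsilon> Q r. ok n k \<epsilon> Q r (Alg n k \<epsilon> Q r)"
    by metis
  then show ?thesis
    unfolding ok_def by (intro exI[of _ "10 ^ 11 :: real"] conjI exI[of _ Alg]) (simp, blast)
qed

end
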